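(* Let $\tau$ be a generic Euclidean triangle with triangle group $G_\tau=\langle r_1,r_2,r_3\rangle$ and rotation subgroup $H_\tau$ (see context). Then $H_\tau$ admits the presentation $$\langle y_2,y_3 \mid [\,c,\ (y_2^ny_3^m)^{-1}\,c\,(y_2^ny_3^m)\,]\ \text{ for } n,m\in\mathbb{Z},\ (n,m)>(0,0)\rangle,\qquad c=[y_2,y_3],$$ with $y_2$ corresponding to the rotation $r_2r_1$ and $y_3$ corresponding to the rotation $r_1r_3$.
   Context: A Euclidean triangle $\tau=A_1A_2A_3$ has edges $e_i=A_jA_k$ of length $\ell_i>0$, $\{i,j,k\}=\{1,2,3\}$. It is generic if for some real $k>0$ the numbers $k\ell_1,k\ell_2,k\ell_3$ are algebraically independent over $\mathbb{Q}$. Let $r_i$ be the reflection of the plane across the line containing $e_i$ and $G_\tau=\langle r_1,r_2,r_3\rangle\subset \mathrm{E}(2)$, with products composed left to right ($(x)gh=((x)g)h$). $H_\tau=G_\tau\cap\mathrm{SE}(2)$ is the subgroup of orientation-preserving elements. Commutators are $[a,b]=aba^{-1}b^{-1}$. The order on pairs is lexicographic: $(n,m)>(0,0)$ means $n>0$, or $n=0$ and $m>0$. *)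

theory Defs
  imports Complex_Main "HOL-Algebra.Algebra"
begin

definition refl_line :: "complex \<Rightarrow> complex \<Rightarrow> complex \<Rightarrow> complex" where
  "refl_line p q = (\<lambda>z. p + (q - p) * cnj ((z - p) / (q - p)))"

text \<open>The group of bijections of the plane, with products composed LEFT TO RIGHT:
  (x)gh = ((x)g)h, i.e. g \<otimes> h = h \<circ> g.  E(2) is a subgroup of it.\<close>
definition plane_perm_group :: "(complex \<Rightarrow> complex) monoid" where
  "plane_perm_group = \<lparr>carrier = {f. bij f}, monoid.mult = (\<lambda>g h. h \<circ> g), one = id\<rparr>"

definition SE2 :: "(complex \<Rightarrow> complex) set" where
  "SE2 = {f. \<exists>a b. norm a = 1 \<and> f = (\<lambda>z. a * z + b)}"

definition tri_refl :: "complex \<Rightarrow> complex \<Rightarrow> complex \<Rightarrow> nat \<Rightarrow> (complex \<Rightarrow> complex)" where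
  "tri_refl A1 A2 A3 i =
     (if i = 1 then refl_line A2 A3 else if i = 2 then refl_line A3 A1 else refl_line A1 A2)"

definition G_tri :: "complex \<Rightarrow> complex \<Rightarrow> complex \<Rightarrow> (complex \<Rightarrow> complex) set" where
  "G_tri A1 A2 A3 = generate plane_perm_group
      {tri_refl A1 A2 A3 1, tri_refl A1 A2 A3 2, tri_refl A1 A2 A3 3}"

definition H_tri :: "complex \<Rightarrow> complex \<Rightarrow> complex \<Rightarrow> (complex \<Rightarrow> complex) monoid" where
  "H_tri A1 A2 A3 = plane_perm_group\<lparr>carrier := G_tri A1 A2 A3 \<inter> SE2\<rparr>"

definition alg_indep3 :: "real \<Rightarrow> real \<Rightarrow> real \<Rightarrow> bool" where
  "alg_indep3 x y z \<longleftrightarrow>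
     (\<forall>c :: nat \<times> nat \<times> nat \<Rightarrow> rat.
        finite {e. c e \<noteq> 0} \<longrightarrow>
        (\<Sum>(i,j,k)\<in>{e. c e \<noteq> 0}. of_rat (c (i,j,k)) * x ^ i * y ^ j * z ^ k) = 0 \<longrightarrow>
        (\<forall>e. c e = 0))"

definition generic_triangle :: "complex \<Rightarrow> complex \<Rightarrow> complex \<Rightarrow> bool" where
  "generic_triangle A1 A2 A3 \<longleftrightarrow>
     (\<exists>k::real. k > 0 \<and>
        alg_indep3 (k * cmod (A2 - A3)) (k * cmod (A1 - A3)) (k * cmod (A1 - A2)))"

definition gcomm :: "('a, 'b) monoid_scheme \<Rightarrow> 'a \<Rightarrow> 'a \<Rightarrow> 'a" where
  "gcomm K a b = a \<otimes>\<^bsub>K\<^esub> b \<otimes>\<^bsub>K\<^esub> inv\<^bsub>K\<^esub> a \<otimes>\<^bsub>K\<^esub> inv\<^bsub>K\<^esub> b"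

definition tri_relator :: "('a, 'b) monoid_scheme \<Rightarrow> 'a \<Rightarrow> 'a \<Rightarrow> int \<Rightarrow> int \<Rightarrow> 'a" where
  "tri_relator K y2 y3 n m =
     (let c = gcomm K y2 y3; w = (y2 [^]\<^bsub>K\<^esub> n) \<otimes>\<^bsub>K\<^esub> (y3 [^]\<^bsub>K\<^esub> m)
      in gcomm K c (inv\<^bsub>K\<^esub> w \<otimes>\<^bsub>K\<^esub> c \<otimes>\<^bsub>K\<^esub> w))"

definition tri_relations_hold :: "('a, 'b) monoid_scheme \<Rightarrow> 'a \<Rightarrow> 'a \<Rightarrow> bool" where
  "tri_relations_hold K y2 y3 \<longleftrightarrow>
     (\<forall>n m :: int. (n > 0 \<or> (n = 0 \<and> m > 0)) \<longrightarrow> tri_relator K y2 y3 n m = \<one>\<^bsub>K\<^esub>)"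

text \<open>H admits the presentation < y2, y3 | relators > with the generators y2, y3 corresponding
  to the given elements a2, a3 of H, i.e. the homomorphism from the free group F(y2,y3) to H
  sending y_i to a_i is surjective with kernel the normal closure of the relators.  Since
  free groups are not available in the library, this is expressed by the (von Dyck)
  universal property of the presented group: a2, a3 generate H, satisfy the relators, and
  for every group K and elements b2, b3 satisfying the relators there is a homomorphism
  H \<rightarrow> K sending a2 \<mapsto> b2, a3 \<mapsto> b3.  The target group K ranges over an arbitrary type.\<close>
definition tri_presentation ::
  "('a, 'b) monoid_scheme \<Rightarrow> 'a \<Rightarrow> 'a \<Rightarrow> ('k, 'm) monoid_scheme itself \<Rightarrow> bool" where
  "tri_presentation H a2 a3 _ \<longleftrightarrow>
     group H \<and> a2 \<in> carrier H \<and> a3 \<in> carrier H \<and>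
     carrier H = generate H {a2, a3} \<and>
     tri_relations_hold H a2 a3 \<and>
     (\<forall>(K :: ('k, 'm) monoid_scheme) b2 b3.
        group K \<and> b2 \<in> carrier K \<and> b3 \<in> carrier K \<and> tri_relations_hold K b2 b3 \<longrightarrow>
        (\<exists>h \<in> hom H K. h a2 = b2 \<and> h a3 = b3))"

end

theory Submission
  imports Defs "HOL-Computational_Algebra.Polynomial"
begin

text \<open>
  The relators make the group generated by \<open>y\<^sub>2, y\<^sub>3\<close> metabelian: the conjugates
  \<open>C n m\<close> of the commutator \<open>c\<close> by \<open>y\<^sub>3\<^sup>m y\<^sub>2\<^sup>n\<close> commute, and conjugation by \<open>y\<^sub>2\<close>
  and \<open>y\<^sub>3\<close> only shifts \<open>n\<close> and \<open>m\<close>, since \<open>y\<^sub>2y\<^sub>3\<close> and \<open>y\<^sub>3y\<^sub>2\<close> differ by \<open>c\<close>.  Hence every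
  element is \<open>y\<^sub>2\<^sup>p y\<^sub>3\<^sup>q\<close> times a product of powers of the \<open>C n m\<close>.

  In the rotation group, \<open>c\<close> is a nontrivial translation and \<open>C n m\<close> is this translation
  multiplied by \<open>u\<^sup>n v\<^sup>m\<close>, where \<open>u, v\<close> are the linear parts of the two rotations.  So the normal
  form is unique as soon as no nonzero integral Laurent polynomial \<open>P\<close> satisfies \<open>P(u, v) = 0\<close>.

  Up to a power of the product of the edge lengths, \<open>|P(u, v)|\<^sup>2\<close> is a rational polynomial in the
  edge lengths.  If it vanishes for one generic triangle it vanishes for all triangles, and the
  pairs \<open>(u, v)\<close> of all triangles contain an infinite grid, so \<open>P = 0\<close>.
\<close>

subsection \<open>Metabelian consequences of the relators\<close>

context group
begin

definition conj_by :: "'a \<Rightarrow> 'a \<Rightarrow> 'a" where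
  "conj_by h g = inv h \<otimes> g \<otimes> h"

lemma inv_mult_cancel_left: "\<lbrakk>a \<in> carrier G; b \<in> carrier G\<rbrakk> \<Longrightarrow> inv a \<otimes> (a \<otimes> b) = b"
  by (simp flip: m_assoc)

lemma mult_inv_cancel_left: "\<lbrakk>a \<in> carrier G; b \<in> carrier G\<rbrakk> \<Longrightarrow> a \<otimes> (inv a \<otimes> b) = b"
  by (simp flip: m_assoc)

lemmas word_simps = m_assoc inv_mult_group inv_mult_cancel_left mult_inv_cancel_left

lemma conj_by_closed [simp]: "\<lbrakk>h \<in> carrier G; g \<in> carrier G\<rbrakk> \<Longrightarrow> conj_by h g \<in> carrier G"
  by (simp add: conj_by_def)

lemma conj_by_one [simp]: "g \<in> carrier G \<Longrightarrow> conj_by \<one> g = g"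
  by (simp add: conj_by_def)

lemma conj_by_mult:
  "\<lbrakk>h \<in> carrier G; a \<in> carrier G; b \<in> carrier G\<rbrakk>
    \<Longrightarrow> conj_by h (a \<otimes> b) = conj_by h a \<otimes> conj_by h b"
  by (simp add: conj_by_def word_simps)

lemma conj_by_inv:
  "\<lbrakk>h \<in> carrier G; a \<in> carrier G\<rbrakk> \<Longrightarrow> conj_by h (inv a) = inv (conj_by h a)"
  by (simp add: conj_by_def word_simps)

lemma conj_by_one_right [simp]: "h \<in> carrier G \<Longrightarrow> conj_by h \<one> = \<one>"
  by (simp add: conj_by_def)

lemma conj_by_conj_by:
  "\<lbrakk>h \<in> carrier G; k \<in> carrier G; g \<in> carrier G\<rbrakk>
    \<Longrightarrow> conj_by k (conj_by h g) = conj_by (h \<otimes> k) g"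
  by (simp add: conj_by_def word_simps)

lemma conj_by_inverse_cancel [simp]:
  "\<lbrakk>h \<in> carrier G; g \<in> carrier G\<rbrakk> \<Longrightarrow> conj_by (inv h) (conj_by h g) = g"
  "\<lbrakk>h \<in> carrier G; g \<in> carrier G\<rbrakk> \<Longrightarrow> conj_by h (conj_by (inv h) g) = g"
  by (simp_all add: conj_by_conj_by)

lemma conj_by_eq_iff [simp]:
  "\<lbrakk>h \<in> carrier G; a \<in> carrier G; b \<in> carrier G\<rbrakk> \<Longrightarrow> conj_by h a = conj_by h b \<longleftrightarrow> a = b"
  by (metis conj_by_inverse_cancel(1))

lemma conj_by_int_pow_add:
  "\<lbrakk>h \<in> carrier G; g \<in> carrier G\<rbrakk>
    \<Longrightarrow> conj_by (h [^] (m::int)) (conj_by (h [^] (n::int)) g) = conj_by (h [^] (n + m)) g"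
  by (simp add: conj_by_conj_by int_pow_mult)

lemma conj_by_commute_iff:
  assumes "h \<in> carrier G" "a \<in> carrier G" "b \<in> carrier G"
  shows "conj_by h a \<otimes> conj_by h b = conj_by h b \<otimes> conj_by h a \<longleftrightarrow> a \<otimes> b = b \<otimes> a"
  using assms by (simp flip: conj_by_mult)

lemma conj_by_commuting:
  assumes "h \<in> carrier G" "g \<in> carrier G" "h \<otimes> g = g \<otimes> h"
  shows "conj_by h g = g"
  using assms by (metis conj_by_def inv_mult_cancel_left m_assoc inv_closed)

lemma gcomm_closed [simp]: "\<lbrakk>a \<in> carrier G; b \<in> carrier G\<rbrakk> \<Longrightarrow> gcomm G a b \<in> carrier G"
  by (simp add: gcomm_def)

lemma gcomm_eq_one_iff:
  assumes "a \<in> carrier G" "b \<in> carrier G"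
  shows "gcomm G a b = \<one> \<longleftrightarrow> a \<otimes> b = b \<otimes> a"
proof -
  have "gcomm G a b = (a \<otimes> b) \<otimes> inv (b \<otimes> a)"
    using assms by (simp add: gcomm_def word_simps)
  then show ?thesis
    using assms by (metis inv_equality inv_inv inv_closed m_closed r_inv)
qed

lemma gcomm_mult_swap:
  "\<lbrakk>a \<in> carrier G; b \<in> carrier G\<rbrakk> \<Longrightarrow> gcomm G a b \<otimes> (b \<otimes> a) = a \<otimes> b"
  by (simp add: gcomm_def word_simps)

lemma commute_generate:
  assumes "S \<subseteq> carrier G" "g \<in> carrier G" "\<And>s. s \<in> S \<Longrightarrow> g \<otimes> s = s \<otimes> g"
    and "a \<in> generate G S"
  shows "g \<otimes> a = a \<otimes> g"
  using assms(4)
proof (induction rule: generate.induct)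
  case (inv h)
  then have "h \<in> carrier G" "g \<otimes> h = h \<otimes> g" using assms(1,3) by auto
  then have "inv h \<otimes> (g \<otimes> h) \<otimes> inv h = inv h \<otimes> (h \<otimes> g) \<otimes> inv h" by simp
  then show ?case using \<open>h \<in> carrier G\<close> assms(2) by (simp add: word_simps)
next
  case (eng a b)
  then have "a \<in> carrier G" "b \<in> carrier G" using generate_in_carrier[OF assms(1)] by auto
  then show ?case using eng.IH assms(2) by (metis m_assoc)
qed (use assms in auto)

lemma conj_by_generate:
  assumes "S \<subseteq> carrier G" "h \<in> carrier G" "\<And>s. s \<in> S \<Longrightarrow> conj_by h s \<in> generate G S"
    and "a \<in> generate G S"
  shows "conj_by h a \<in> generate G S"
  using assms(4)
proof (induction rule: generate.induct)
  case one
  show ?case using assms(2) by (simp add: generate.one)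
next
  case (incl a)
  then show ?case using assms(3) by auto
next
  case (inv a)
  then show ?case
    using assms(1-3) generate_m_inv_closed[OF assms(1)] by (metis conj_by_inv subsetD)
next
  case (eng a b)
  then have "a \<in> carrier G" "b \<in> carrier G"
    using generate_in_carrier[OF assms(1)] by auto
  then show ?case
    using assms(2) eng.IH by (simp add: conj_by_mult generate.eng)
qed

end

lemma (in group_hom) hom_gcomm:
  "\<lbrakk>a \<in> carrier G; b \<in> carrier G\<rbrakk> \<Longrightarrow> h (gcomm G a b) = gcomm H (h a) (h b)"
  by (simp add: gcomm_def)

lemma (in group_hom) hom_tri_relator:
  "\<lbrakk>a \<in> carrier G; b \<in> carrier G\<rbrakk>
    \<Longrightarrow> h (tri_relator G a b n m) = tri_relator H (h a) (h b) n m"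
  by (simp add: tri_relator_def Let_def hom_gcomm hom_int_pow)

locale tri_relations = group G for G (structure) +
  fixes x y
  assumes x_closed [simp]: "x \<in> carrier G" and y_closed [simp]: "y \<in> carrier G"
    and relations: "tri_relations_hold G x y"
begin

definition c where "c = gcomm G x y"

definition C :: "int \<Rightarrow> int \<Rightarrow> 'a" where
  "C n m = conj_by (x [^] n) (conj_by (y [^] m) c)"

lemma c_closed [simp]: "c \<in> carrier G"
  by (simp add: c_def)

lemma C_closed [simp]: "C n m \<in> carrier G"
  by (simp add: C_def)

lemma C_zero_zero [simp]: "C 0 0 = c"
  by (simp add: C_def)

lemma conj_x_conj_y_commute:
  assumes "g \<in> carrier G" "c \<otimes> g = g \<otimes> c"
  shows "conj_by x (conj_by y g) = conj_by y (conj_by x g)"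
proof -
  have "conj_by y (conj_by x g) = conj_by (c \<otimes> (y \<otimes> x)) g"
    using assms by (simp add: conj_by_conj_by c_def gcomm_mult_swap)
  also have "\<dots> = conj_by (y \<otimes> x) (conj_by c g)"
    using assms by (simp add: conj_by_conj_by)
  also have "conj_by c g = g"
    using assms by (simp add: conj_by_commuting)
  finally show ?thesis
    using assms by (simp add: conj_by_conj_by)
qed

lemma c_commutes_relation:
  fixes n m :: int
  assumes "n > 0 \<or> (n = 0 \<and> m > 0)"
  shows "c \<otimes> conj_by (y [^] m) (conj_by (x [^] n) c)
       = conj_by (y [^] m) (conj_by (x [^] n) c) \<otimes> c"
proof -
  have "tri_relator G x y n m = \<one>"
    using relations assms unfolding tri_relations_hold_def by blast
  moreover have "tri_relator G x y n m = gcomm G c (conj_by (y [^] m) (conj_by (x [^] n) c))"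
    by (simp add: tri_relator_def Let_def conj_by_conj_by) (simp add: conj_by_def c_def)
  ultimately show ?thesis
    by (simp add: gcomm_eq_one_iff)
qed

lemma c_commutes_nonneg:
  fixes n m :: int
  assumes "n \<ge> 0"
  shows "c \<otimes> conj_by (y [^] m) (conj_by (x [^] n) c)
       = conj_by (y [^] m) (conj_by (x [^] n) c) \<otimes> c"
proof (cases "n > 0 \<or> m > 0")
  case True
  then show ?thesis using c_commutes_relation[of n m] assms by force
next
  case False
  then have [simp]: "n = 0" using assms by simp
  show ?thesis
  proof (cases "m = 0")
    case False
    then have "- m > 0" using \<open>\<not> (n > 0 \<or> m > 0)\<close> by simp
    then have "c \<otimes> conj_by (y [^] (-m)) c = conj_by (y [^] (-m)) c \<otimes> c"
      using c_commutes_relation[of 0 "-m"] by simp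
    then have "conj_by (y [^] m) c \<otimes> conj_by (y [^] m) (conj_by (y [^] (-m)) c)
      = conj_by (y [^] m) (conj_by (y [^] (-m)) c) \<otimes> conj_by (y [^] m) c"
      by (simp add: conj_by_commute_iff)
    then show ?thesis by (simp add: conj_by_int_pow_add)
  qed simp
qed

lemma conj_x_shift_nonneg:
  fixes n m :: int
  assumes "n \<ge> 0"
  shows "conj_by (y [^] m) (conj_by (x [^] (n + 1)) c)
       = conj_by x (conj_by (y [^] m) (conj_by (x [^] n) c))"
proof (induction m rule: int_induct[where k = 0])
  case base
  then show ?case using conj_by_int_pow_add[of x c 1 n] by simp
next
  case (step1 i)
  let ?D = "\<lambda>n m. conj_by (y [^] m) (conj_by (x [^] n) c)"
  have y: "?D n (i + 1) = conj_by y (?D n i)" for n :: int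
    using conj_by_int_pow_add[of y "conj_by (x [^] n) c" 1 i] by simp
  show ?case
    unfolding y step1.IH using c_commutes_nonneg[OF assms, of i]
    by (simp add: conj_x_conj_y_commute)
next
  case (step2 i)
  let ?D = "\<lambda>n m. conj_by (y [^] m) (conj_by (x [^] n) c)"
  have y: "?D n i = conj_by y (?D n (i - 1))" for n :: int
    using conj_by_int_pow_add[of y "conj_by (x [^] n) c" 1 "i - 1"] by simp
  have "conj_by y (?D (n + 1) (i - 1)) = conj_by y (conj_by x (?D n (i - 1)))"
    using step2.IH unfolding y using c_commutes_nonneg[OF assms, of "i - 1"]
    by (simp add: conj_x_conj_y_commute)
  then show ?case by simp
qed

lemma conj_x_C: "conj_by x (C n m) = C (n + 1) m"
  using conj_by_int_pow_add[of x "conj_by (y [^] m) c" 1 n] by (simp add: C_def)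

lemma C_nonneg:
  fixes n m :: int
  assumes "n \<ge> 0"
  shows "conj_by (y [^] m) (conj_by (x [^] n) c) = C n m"
  using assms
proof (induction n rule: int_ge_induct)
  case base
  then show ?case by (simp add: C_def)
next
  case (step n)
  then show ?case by (simp add: conj_x_shift_nonneg conj_x_C)
qed

lemma C_commute: "C n m \<otimes> C n' m' = C n' m' \<otimes> C n m"
proof -
  have *: "C n m \<otimes> C n' m' = C n' m' \<otimes> C n m" if "n \<le> n'" for n n' m m'
  proof -
    have "c \<otimes> conj_by (y [^] (m' - m)) (conj_by (x [^] (n' - n)) c)
        = conj_by (y [^] (m' - m)) (conj_by (x [^] (n' - n)) c) \<otimes> c"
      using that by (simp add: c_commutes_nonneg)
    then have "conj_by (y [^] m) c \<otimes> conj_by (y [^] m') (conj_by (x [^] (n' - n)) c)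
        = conj_by (y [^] m') (conj_by (x [^] (n' - n)) c) \<otimes> conj_by (y [^] m) c"
      using conj_by_commute_iff[of "y [^] m" c "conj_by (y [^] (m' - m)) (conj_by (x [^] (n' - n)) c)"]
      by (simp add: conj_by_int_pow_add)
    then have "C 0 m \<otimes> C (n' - n) m' = C (n' - n) m' \<otimes> C 0 m"
      using that by (simp add: C_nonneg C_def)
    then have "conj_by (x [^] n) (C 0 m) \<otimes> conj_by (x [^] n) (C (n' - n) m')
        = conj_by (x [^] n) (C (n' - n) m') \<otimes> conj_by (x [^] n) (C 0 m)"
      by (simp add: conj_by_commute_iff)
    then show ?thesis
      by (simp add: C_def conj_by_int_pow_add)
  qed
  show ?thesis
    by (cases "n \<le> n'") (use *[of n n' m m'] *[of n' n m' m] in auto)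
qed

lemma conj_y_C: "conj_by y (C n m) = C n (m + 1)"
proof (induction n rule: int_induct[where k = 0])
  case base
  then show ?case using conj_by_int_pow_add[of y c 1 m] by (simp add: C_def)
next
  have comm: "conj_by x (conj_by y (C i m)) = conj_by y (conj_by x (C i m))" for i
    by (rule conj_x_conj_y_commute) (use C_commute[of 0 0] in simp_all)
  {
    case (step1 i)
    then show ?case using comm[of i] by (simp add: conj_x_C)
  next
    case (step2 i)
    have "conj_by x (conj_by y (C (i - 1) m)) = conj_by x (C (i - 1) (m + 1))"
      using step2 comm[of "i - 1"] by (simp add: conj_x_C)
    then show ?case by simp
  }
qed

definition N where "N = generate G (range (case_prod C))"

lemma range_C_subset: "range (case_prod C) \<subseteq> carrier G"
  by auto

lemma subgroup_N: "subgroup N G"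
  unfolding N_def by (rule generate_is_subgroup[OF range_C_subset])

lemma N_closed [simp]: "\<nu> \<in> N \<Longrightarrow> \<nu> \<in> carrier G"
  using subgroup.mem_carrier[OF subgroup_N] .

lemma C_in_N [simp]: "C n m \<in> N"
  unfolding N_def by (rule generate.incl) force

lemma comm_group_N: "comm_group (G\<lparr>carrier := N\<rparr>)"
proof (rule group.group_comm_groupI)
  show "group (G\<lparr>carrier := N\<rparr>)"
    by (rule subgroup_imp_group[OF subgroup_N])
next
  fix a b assume "a \<in> carrier (G\<lparr>carrier := N\<rparr>)" "b \<in> carrier (G\<lparr>carrier := N\<rparr>)"
  then have ab: "a \<in> N" "b \<in> N" by simp_all
  have "C n m \<otimes> a = a \<otimes> C n m" for n m
    using ab(1) unfolding N_def
    by (rule commute_generate[OF range_C_subset, rotated 2]) (auto intro: C_commute)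
  then have "a \<otimes> b = b \<otimes> a"
    using ab(2) unfolding N_def
    by (intro commute_generate[OF range_C_subset, of a b]) (use ab in auto)
  then show "a \<otimes>\<^bsub>G\<lparr>carrier := N\<rparr>\<^esub> b = b \<otimes>\<^bsub>G\<lparr>carrier := N\<rparr>\<^esub> a" by simp
qed

lemma conj_by_in_N:
  assumes "h \<in> carrier G" "\<And>n m. conj_by h (C n m) \<in> N" "\<nu> \<in> N"
  shows "conj_by h \<nu> \<in> N"
  unfolding N_def
proof (rule conj_by_generate[OF range_C_subset assms(1)])
  show "conj_by h s \<in> generate G (range (case_prod C))" if "s \<in> range (case_prod C)" for s
    using that assms(2) by (auto simp flip: N_def)
qed (use assms(3) in \<open>simp flip: N_def\<close>)

lemma conj_by_inv_eqI:
  "\<lbrakk>h \<in> carrier G; a \<in> carrier G; conj_by h a = b\<rbrakk> \<Longrightarrow> conj_by (inv h) b = a"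
  by auto

lemma conj_generators_N:
  assumes "\<nu> \<in> N"
  shows "conj_by x \<nu> \<in> N" "conj_by y \<nu> \<in> N" "conj_by (inv x) \<nu> \<in> N" "conj_by (inv y) \<nu> \<in> N"
proof -
  have shift: "conj_by (inv x) (C n m) = C (n - 1) m" "conj_by (inv y) (C n m) = C n (m - 1)" for n m
    by (auto intro!: conj_by_inv_eqI simp: conj_x_C conj_y_C)
  show "conj_by x \<nu> \<in> N" "conj_by y \<nu> \<in> N" "conj_by (inv x) \<nu> \<in> N" "conj_by (inv y) \<nu> \<in> N"
    by (rule conj_by_in_N[OF _ _ assms]; simp add: conj_x_C conj_y_C shift)+
qed

lemma mult_conj_by_N:
  assumes "h \<in> {x, y, inv x, inv y}" "a \<in> carrier G" "\<nu> \<in> N"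
  obtains \<nu>' where "\<nu>' \<in> N" "a \<otimes> \<nu> \<otimes> h = a \<otimes> h \<otimes> \<nu>'"
proof
  show "conj_by h \<nu> \<in> N" using assms conj_generators_N by auto
  have "h \<in> carrier G" using assms(1) by auto
  then show "a \<otimes> \<nu> \<otimes> h = a \<otimes> h \<otimes> conj_by h \<nu>"
    using assms(2,3) by (simp add: conj_by_def word_simps)
qed

lemma y_pow_mult_x: "\<exists>\<nu>\<in>N. y [^] (q::int) \<otimes> x = x \<otimes> y [^] q \<otimes> \<nu>"
proof (induction q rule: int_induct[where k = 0])
  case base
  then show ?case using subgroup.one_closed[OF subgroup_N] by force
next
  case (step1 i)
  then obtain \<nu> where \<nu>: "\<nu> \<in> N" "y [^] i \<otimes> x = x \<otimes> y [^] i \<otimes> \<nu>" by blast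
  define \<mu> where "\<mu> = inv (conj_by y (conj_by x c))"
  have \<mu>: "\<mu> \<in> N"
    using conj_generators_N subgroup.m_inv_closed[OF subgroup_N] C_in_N[of 0 0] by (simp add: \<mu>_def)
  have yx: "y \<otimes> x = x \<otimes> y \<otimes> \<mu>"
    by (simp add: \<mu>_def conj_by_def c_def gcomm_def word_simps)
  obtain \<nu>' where \<nu>': "\<nu>' \<in> N" "x \<otimes> y [^] i \<otimes> \<nu> \<otimes> y = x \<otimes> y [^] i \<otimes> y \<otimes> \<nu>'"
    using mult_conj_by_N[of y "x \<otimes> y [^] i" \<nu>] \<nu>(1) by auto
  have "y [^] (i + 1) \<otimes> x = y [^] i \<otimes> (y \<otimes> x)"
    by (simp add: int_pow_mult m_assoc)
  also have "\<dots> = (y [^] i \<otimes> x) \<otimes> y \<otimes> \<mu>"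
    unfolding yx using \<mu> by (simp add: m_assoc)
  also have "\<dots> = x \<otimes> y [^] (i + 1) \<otimes> (\<nu>' \<otimes> \<mu>)"
    unfolding \<nu>(2) \<nu>'(2) using \<mu> \<nu>' by (simp add: m_assoc int_pow_mult)
  finally show ?case
    using subgroup.m_closed[OF subgroup_N \<nu>'(1) \<mu>] by blast
next
  case (step2 i)
  then obtain \<nu> where \<nu>: "\<nu> \<in> N" "y [^] i \<otimes> x = x \<otimes> y [^] i \<otimes> \<nu>" by blast
  define \<mu> where "\<mu> = conj_by x c"
  have \<mu>: "\<mu> \<in> N"
    using conj_generators_N C_in_N[of 0 0] by (simp add: \<mu>_def)
  have yx: "inv y \<otimes> x = x \<otimes> inv y \<otimes> \<mu>"
    by (simp add: \<mu>_def conj_by_def c_def gcomm_def word_simps)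
  obtain \<nu>' where \<nu>': "\<nu>' \<in> N" "x \<otimes> y [^] i \<otimes> \<nu> \<otimes> inv y = x \<otimes> y [^] i \<otimes> inv y \<otimes> \<nu>'"
    using mult_conj_by_N[of "inv y" "x \<otimes> y [^] i" \<nu>] \<nu>(1) by auto
  have pow: "y [^] (i - 1) = y [^] i \<otimes> inv y"
    by (simp add: int_pow_diff)
  have "y [^] (i - 1) \<otimes> x = y [^] i \<otimes> (inv y \<otimes> x)"
    by (simp add: pow m_assoc)
  also have "\<dots> = (y [^] i \<otimes> x) \<otimes> inv y \<otimes> \<mu>"
    unfolding yx using \<mu> by (simp add: m_assoc)
  also have "\<dots> = x \<otimes> y [^] (i - 1) \<otimes> (\<nu>' \<otimes> \<mu>)"
    unfolding \<nu>(2) \<nu>'(2) pow using \<mu> \<nu>' by (simp add: m_assoc)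
  finally show ?case
    using subgroup.m_closed[OF subgroup_N \<nu>'(1) \<mu>] by blast
qed

lemma y_pow_mult_inv_x: "\<exists>\<nu>\<in>N. y [^] (q::int) \<otimes> inv x = inv x \<otimes> y [^] q \<otimes> \<nu>"
proof -
  obtain \<nu> where \<nu>: "\<nu> \<in> N" "y [^] q \<otimes> x = x \<otimes> y [^] q \<otimes> \<nu>" using y_pow_mult_x by blast
  obtain \<nu>' where \<nu>': "\<nu>' \<in> N" "y [^] q \<otimes> \<nu> \<otimes> inv x = y [^] q \<otimes> inv x \<otimes> \<nu>'"
    using mult_conj_by_N[of "inv x" "y [^] q" \<nu>] \<nu>(1) by auto
  have "inv x \<otimes> y [^] q = inv x \<otimes> (y [^] q \<otimes> x) \<otimes> inv x"
    by (simp add: m_assoc)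
  also have "\<dots> = y [^] q \<otimes> inv x \<otimes> \<nu>'"
    unfolding \<nu>(2) \<nu>'(2)[symmetric] using \<nu>(1) by (simp add: word_simps)
  finally have "inv x \<otimes> y [^] q \<otimes> inv \<nu>' = y [^] q \<otimes> inv x"
    using \<nu>' by (simp add: m_assoc)
  then show ?thesis
    using subgroup.m_inv_closed[OF subgroup_N \<nu>'(1)] by metis
qed

lemma normal_form_mult_generator:
  assumes "h \<in> {x, y, inv x, inv y}" "\<nu> \<in> N"
  shows "\<exists>p' q'. \<exists>\<nu>'\<in>N. x [^] (p::int) \<otimes> y [^] (q::int) \<otimes> \<nu> \<otimes> h = x [^] (p'::int) \<otimes> y [^] (q'::int) \<otimes> \<nu>'"
proof -
  obtain \<mu> where \<mu>: "\<mu> \<in> N"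
      "x [^] p \<otimes> y [^] q \<otimes> \<nu> \<otimes> h = x [^] p \<otimes> y [^] q \<otimes> h \<otimes> \<mu>"
    using mult_conj_by_N[OF assms(1) _ assms(2)] by (metis int_pow_closed m_closed x_closed y_closed)
  have y_cases: ?thesis if "y [^] q \<otimes> h = y [^] (q'::int)" "h \<in> carrier G" for q'
    using \<mu> that by (metis int_pow_closed m_assoc x_closed y_closed)
  have x_cases: ?thesis
    if "\<rho> \<in> N" "y [^] q \<otimes> h = h \<otimes> y [^] q \<otimes> \<rho>" "h \<in> carrier G" "x [^] p \<otimes> h = x [^] (p'::int)" for p' \<rho>
  proof -
    have "x [^] p \<otimes> y [^] q \<otimes> h \<otimes> \<mu> = x [^] p \<otimes> (y [^] q \<otimes> h) \<otimes> \<mu>"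
      using that \<mu>(1) by (simp add: m_assoc)
    also have "\<dots> = (x [^] p \<otimes> h) \<otimes> y [^] q \<otimes> (\<rho> \<otimes> \<mu>)"
      unfolding that(2) using that(1,3) \<mu>(1) by (simp add: m_assoc)
    finally show ?thesis
      using \<mu>(2) that(4) subgroup.m_closed[OF subgroup_N that(1) \<mu>(1)] by auto
  qed
  have step: "a [^] i \<otimes> a = a [^] (i + 1)" "a [^] i \<otimes> inv a = a [^] (i - 1)"
    if "a \<in> carrier G" for a and i :: int
    using that by (simp_all add: int_pow_mult int_pow_diff)
  from assms(1) consider "h = x" | "h = y" | "h = inv x" | "h = inv y" by blast
  then show ?thesis
  proof cases
    case 1
    then show ?thesis using x_cases[of _ "p + 1"] y_pow_mult_x[of q] step by auto
  next
    case 2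
    then show ?thesis using y_cases[of "q + 1"] step by simp
  next
    case 3
    then show ?thesis using x_cases[of _ "p - 1"] y_pow_mult_inv_x[of q] step by auto
  next
    case 4
    then show ?thesis using y_cases[of "q - 1"] step by simp
  qed
qed

lemma normal_form:
  assumes "g \<in> generate G {x, y}"
  shows "\<exists>p q. \<exists>\<nu>\<in>N. g = x [^] (p::int) \<otimes> y [^] (q::int) \<otimes> \<nu>"
proof -
  let ?S = "{x [^] (p::int) \<otimes> y [^] (q::int) \<otimes> \<nu> | p q \<nu>. \<nu> \<in> N}"
  have S: "?S \<subseteq> carrier G" by auto
  have mult: "s \<otimes> h \<in> ?S" if "h \<in> {x, y, inv x, inv y}" "s \<in> ?S" for s h
    using normal_form_mult_generator[OF that(1)] that(2) by blast
  have "\<forall>s\<in>?S. s \<otimes> g \<in> ?S"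
    using assms
  proof (induction rule: generate.induct)
    case one
    then show ?case using S by (auto simp: subset_iff)
  next
    case (incl h)
    then show ?case using mult[of h] by blast
  next
    case (inv h)
    then show ?case using mult[of "inv h"] by blast
  next
    case (eng a b)
    then have "a \<in> carrier G" "b \<in> carrier G"
      using generate_in_carrier[of "{x, y}"] by auto
    moreover have "s \<otimes> a \<otimes> b \<in> ?S" if "s \<in> ?S" for s
      using that eng.IH by blast
    ultimately show ?case using S by (metis (no_types, lifting) m_assoc subsetD)
  qed
  moreover have "\<one> \<in> ?S"
    using subgroup.one_closed[OF subgroup_N]
    by (auto intro!: exI[of _ "0::int"] exI[of _ "\<one>"])
  moreover have "g \<in> carrier G"
    using assms generate_in_carrier[of "{x, y}"] by auto
  ultimately have "g \<in> ?S" by (metis (no_types, lifting) l_one)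
  then show ?thesis by blast
qed

lemma N_parametrization:
  obtains \<Phi> where "\<Phi> \<in> hom (free_Abelian_group UNIV) (G\<lparr>carrier := N\<rparr>)"
    "\<And>n m. \<Phi> (frag_of (n, m)) = C n m" "range \<Phi> = N"
proof -
  interpret N: comm_group "G\<lparr>carrier := N\<rparr>" by (rule comm_group_N)
  obtain \<Phi> where \<Phi>: "\<Phi> \<in> hom (free_Abelian_group UNIV) (G\<lparr>carrier := N\<rparr>)"
    "\<And>s. s \<in> UNIV \<Longrightarrow> \<Phi> (frag_of s) = case_prod C s"
  proof (rule N.free_Abelian_group_universal[of "case_prod C" UNIV])
    show "range (case_prod C) \<subseteq> carrier (G\<lparr>carrier := N\<rparr>)" by auto
  qed blast
  interpret \<Phi>: group_hom "free_Abelian_group UNIV" "G\<lparr>carrier := N\<rparr>" \<Phi>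
    by (simp add: \<Phi> group_hom_axioms_def group_hom_def N.is_group)
  have "N \<subseteq> range \<Phi>"
  proof
    fix \<nu> assume "\<nu> \<in> N"
    then show "\<nu> \<in> range \<Phi>"
      unfolding N_def
    proof (induction rule: generate.induct)
      case one
      then show ?case using \<Phi>.hom_one by (intro range_eqI[of _ _ 0]) simp
    next
      case (incl a)
      then obtain s where "a = \<Phi> (frag_of s)" using \<Phi>(2) by auto
      then show ?case by blast
    next
      case (inv a)
      then obtain s where s: "a = \<Phi> (frag_of s)" using \<Phi>(2) by auto
      then have "\<Phi> (- frag_of s) = inv\<^bsub>G\<lparr>carrier := N\<rparr>\<^esub> a"
        using \<Phi>.hom_inv[of "frag_of s"] by simp
      moreover have "a \<in> N" using s \<Phi>.hom_closed[of "frag_of s"] by simp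
      ultimately show ?case 
        using m_inv_consistent[OF subgroup_N] by (intro range_eqI[of _ _ "- frag_of s"]) simp
    next
      case (eng a b)
      then obtain f g where "a = \<Phi> f" "b = \<Phi> g" by blast
      then have "a \<otimes> b = \<Phi> (f + g)" using \<Phi>.hom_mult[of f g] by simp
      then show ?case by blast
    qed
  qed
  moreover have "range \<Phi> \<subseteq> N" using \<Phi>.hom_closed by auto
  ultimately show ?thesis using that \<Phi> by auto
qed

end

lemma (in group_hom) hom_conj_by:
  "\<lbrakk>a \<in> carrier G; b \<in> carrier G\<rbrakk> \<Longrightarrow> h (G.conj_by a b) = H.conj_by (h a) (h b)"
  by (simp add: G.conj_by_def H.conj_by_def)

lemma group_hom_fst: "\<lbrakk>group H; group K\<rbrakk> \<Longrightarrow> group_hom (H \<times>\<times> K) H fst"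
  by (auto simp: group_hom_def group_hom_axioms_def hom_def DirProd_group)

lemma group_hom_snd: "\<lbrakk>group H; group K\<rbrakk> \<Longrightarrow> group_hom (H \<times>\<times> K) K snd"
  by (auto simp: group_hom_def group_hom_axioms_def hom_def DirProd_group)

lemma tri_relations_hold_DirProd:
  assumes "group H" "group K" "a2 \<in> carrier H" "a3 \<in> carrier H" "b2 \<in> carrier K" "b3 \<in> carrier K"
    and "tri_relations_hold H a2 a3" "tri_relations_hold K b2 b3"
  shows "tri_relations_hold (H \<times>\<times> K) (a2, b2) (a3, b3)"
proof -
  interpret f: group_hom "H \<times>\<times> K" H fst by (rule group_hom_fst) fact+
  interpret s: group_hom "H \<times>\<times> K" K snd by (rule group_hom_snd) fact+
  have "fst (tri_relator (H \<times>\<times> K) (a2, b2) (a3, b3) n m) = tri_relator H a2 a3 n m"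
       "snd (tri_relator (H \<times>\<times> K) (a2, b2) (a3, b3) n m) = tri_relator K b2 b3 n m" for n m
    using assms f.hom_tri_relator[of "(a2, b2)" "(a3, b3)" n m]
      s.hom_tri_relator[of "(a2, b2)" "(a3, b3)" n m] by auto
  then show ?thesis
    using assms(7,8) by (simp add: tri_relations_hold_def prod_eq_iff)
qed

text \<open>The homomorphism is obtained from its graph, the subgroup of \<open>H \<times>\<times> K\<close> generated
  by the pairs of corresponding generators.\<close>

lemma presentation_hom_exists:
  fixes H :: "('a, 'c) monoid_scheme" and K :: "('b, 'd) monoid_scheme"
  assumes H: "group H" "a2 \<in> carrier H" "a3 \<in> carrier H" "tri_relations_hold H a2 a3"
    and gen: "carrier H = generate H {a2, a3}"
    and faithful: "\<And>p q \<Phi> f.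
      \<lbrakk>\<Phi> \<in> hom (free_Abelian_group UNIV) H;
       \<And>n m. \<Phi> (frag_of (n, m)) = tri_relations.C H a2 a3 n m;
       a2 [^]\<^bsub>H\<^esub> (p::int) \<otimes>\<^bsub>H\<^esub> a3 [^]\<^bsub>H\<^esub> (q::int) \<otimes>\<^bsub>H\<^esub> \<Phi> f = \<one>\<^bsub>H\<^esub>\<rbrakk>
      \<Longrightarrow> p = 0 \<and> q = 0 \<and> f = 0"
    and K: "group K" "b2 \<in> carrier K" "b3 \<in> carrier K" "tri_relations_hold K b2 b3"
  shows "\<exists>h\<in>hom H K. h a2 = b2 \<and> h a3 = b3"
proof -
  interpret H: tri_relations H a2 a3
    using H by (simp add: tri_relations_def tri_relations_axioms_def)
  interpret K: group K by fact
  interpret P: tri_relations "H \<times>\<times> K" "(a2, b2)" "(a3, b3)"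
    using H K tri_relations_hold_DirProd[of H K a2 a3 b2 b3]
    by (simp add: tri_relations_def tri_relations_axioms_def DirProd_group)
  interpret f: group_hom "H \<times>\<times> K" H fst by (rule group_hom_fst) fact+
  define L where "L = generate (H \<times>\<times> K) {(a2, b2), (a3, b3)}"
  have L_subset: "{(a2, b2), (a3, b3)} \<subseteq> carrier (H \<times>\<times> K)" using H K by simp
  have L_sub: "subgroup L (H \<times>\<times> K)"
    unfolding L_def by (rule P.generate_is_subgroup[OF L_subset])
  have trivial: "k = \<one>\<^bsub>K\<^esub>" if L: "(\<one>\<^bsub>H\<^esub>, k) \<in> L" for k
  proof -
    obtain p q \<nu> where \<nu>: "\<nu> \<in> P.N" and eq: "(\<one>\<^bsub>H\<^esub>, k) =
        (a2, b2) [^]\<^bsub>H \<times>\<times> K\<^esub> (p::int) \<otimes>\<^bsub>H \<times>\<times> K\<^esub> (a3, b3) [^]\<^bsub>H \<times>\<times> K\<^esub> (q::int) \<otimes>\<^bsub>H \<times>\<times> K\<^esub> \<nu>"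
      using P.normal_form[OF L[unfolded L_def]] by blast
    obtain \<Phi> where \<Phi>: "\<Phi> \<in> hom (free_Abelian_group UNIV) ((H \<times>\<times> K)\<lparr>carrier := P.N\<rparr>)"
      "\<And>n m. \<Phi> (frag_of (n, m)) = P.C n m" "range \<Phi> = P.N"
      using P.N_parametrization by blast
    obtain f where f: "\<nu> = \<Phi> f" using \<nu> \<Phi>(3) by blast
    have mem: "\<Phi> f \<in> carrier (H \<times>\<times> K)" for f
      using \<Phi>(3) P.N_closed by blast
    have \<Phi>_mult: "\<Phi> (f + g) = \<Phi> f \<otimes>\<^bsub>H \<times>\<times> K\<^esub> \<Phi> g" for f g
      using hom_mult[OF \<Phi>(1), of f g] by simp
    have "fst \<circ> \<Phi> \<in> hom (free_Abelian_group UNIV) H"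
      by (rule homI) (use mem in \<open>simp_all add: \<Phi>_mult f.hom_mult f.hom_closed\<close>)
    moreover have "(fst \<circ> \<Phi>) (frag_of (n, m)) = H.C n m" for n m
    proof -
      have "fst (P.C n m) = H.conj_by (fst (a2, b2) [^]\<^bsub>H\<^esub> n)
          (H.conj_by (fst (a3, b3) [^]\<^bsub>H\<^esub> m) (gcomm H (fst (a2, b2)) (fst (a3, b3))))"
        unfolding P.C_def P.c_def
        by (simp only: f.hom_conj_by f.hom_int_pow f.hom_gcomm P.x_closed P.y_closed
            P.int_pow_closed P.conj_by_closed P.gcomm_closed)
      then show ?thesis by (simp add: \<Phi>(2) H.C_def H.c_def)
    qed
    moreover have "a2 [^]\<^bsub>H\<^esub> p \<otimes>\<^bsub>H\<^esub> a3 [^]\<^bsub>H\<^esub> q \<otimes>\<^bsub>H\<^esub> (fst \<circ> \<Phi>) f = \<one>\<^bsub>H\<^esub>"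
    proof -
      have "fst (\<one>\<^bsub>H\<^esub>, k) = fst ((a2, b2)) [^]\<^bsub>H\<^esub> p \<otimes>\<^bsub>H\<^esub> fst (a3, b3) [^]\<^bsub>H\<^esub> q \<otimes>\<^bsub>H\<^esub> fst (\<Phi> f)"
        unfolding eq f
        by (simp only: f.hom_mult f.hom_int_pow P.x_closed P.y_closed P.int_pow_closed P.m_closed mem)
      then show ?thesis by simp
    qed
    ultimately have "p = 0 \<and> q = 0 \<and> f = 0" by (rule faithful)
    moreover have "\<Phi> 0 = \<one>\<^bsub>H \<times>\<times> K\<^esub>"
      using \<Phi>_mult[of 0 0] mem[of 0] P.r_cancel_one[of "\<Phi> 0" "\<Phi> 0"] by simp
    ultimately have "(\<one>\<^bsub>H\<^esub>, k) = \<one>\<^bsub>H \<times>\<times> K\<^esub>" using eq f by simp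
    then show ?thesis by simp
  qed
  have unique: "k = k'" if "(g, k) \<in> L" "(g, k') \<in> L" for g k k'
  proof -
    have mem: "g \<in> carrier H" "k \<in> carrier K" "k' \<in> carrier K"
      using subgroup.mem_carrier[OF L_sub] that by auto
    have "(g, k) \<otimes>\<^bsub>H \<times>\<times> K\<^esub> inv\<^bsub>H \<times>\<times> K\<^esub> (g, k') \<in> L"
      using L_sub that by (blast intro: subgroup.m_closed subgroup.m_inv_closed)
    then have "k \<otimes>\<^bsub>K\<^esub> inv\<^bsub>K\<^esub> k' = \<one>\<^bsub>K\<^esub>"
      using mem H.is_group K.is_group by (simp add: trivial)
    then show ?thesis using mem by (metis K.inv_equality K.inv_inv K.inv_closed)
  qed
  have exists: "\<exists>k. (g, k) \<in> L" if "g \<in> carrier H" for g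
  proof -
    have "generate H (fst ` {(a2, b2), (a3, b3)}) = fst ` L"
      unfolding L_def by (rule f.generate_img[OF L_subset])
    then have "g \<in> fst ` L" using that gen by simp
    then show ?thesis by force
  qed
  define h where "h g = (THE k. (g, k) \<in> L)" for g
  have h_eq: "h g = k" if "(g, k) \<in> L" for g k
    unfolding h_def using that unique by blast
  have h_mem: "(g, h g) \<in> L" if "g \<in> carrier H" for g
    using exists[OF that] h_eq by blast
  have "h \<in> hom H K"
  proof (rule homI)
    fix g assume "g \<in> carrier H"
    then show "h g \<in> carrier K" using subgroup.mem_carrier[OF L_sub h_mem] by simp
  next
    fix g g' assume "g \<in> carrier H" "g' \<in> carrier H"
    then have "(g, h g) \<otimes>\<^bsub>H \<times>\<times> K\<^esub> (g', h g') \<in> L"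
      using h_mem subgroup.m_closed[OF L_sub] by blast
    then show "h (g \<otimes>\<^bsub>H\<^esub> g') = h g \<otimes>\<^bsub>K\<^esub> h g'" by (simp add: h_eq)
  qed
  moreover have "h a2 = b2" "h a3 = b3"
    by (rule h_eq; simp add: L_def generate.incl)+
  ultimately show ?thesis by blast
qed

subsection \<open>Rational functions of the edge lengths\<close>

inductive rat_poly3 :: "(real \<Rightarrow> real \<Rightarrow> real \<Rightarrow> real) \<Rightarrow> bool" where
  zero: "rat_poly3 (\<lambda>x y z. 0)"
| add_monom: "rat_poly3 f \<Longrightarrow> rat_poly3 (\<lambda>x y z. f x y z + of_rat q * x ^ i * y ^ j * z ^ k)"

lemma rat_poly3_monom: "rat_poly3 (\<lambda>x y z. of_rat q * x ^ i * y ^ j * z ^ k)"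
  using rat_poly3.add_monom[OF rat_poly3.zero] by simp

lemma rat_poly3_of_rat: "rat_poly3 (\<lambda>x y z. of_rat q)"
  using rat_poly3_monom[of q 0 0 0] by simp

lemma rat_poly3_one: "rat_poly3 (\<lambda>x y z. 1)"
  using rat_poly3_of_rat[of 1] by simp

lemma rat_poly3_vars: "rat_poly3 (\<lambda>x y z. x)" "rat_poly3 (\<lambda>x y z. y)" "rat_poly3 (\<lambda>x y z. z)"
  using rat_poly3_monom[of 1 1 0 0] rat_poly3_monom[of 1 0 1 0] rat_poly3_monom[of 1 0 0 1]
  by simp_all

lemma rat_poly3_add:
  assumes "rat_poly3 f" "rat_poly3 g"
  shows "rat_poly3 (\<lambda>x y z. f x y z + g x y z)"
  using assms(2)
proof (induction rule: rat_poly3.induct)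
  case zero
  then show ?case using assms(1) by simp
next
  case (add_monom g q i j k)
  from rat_poly3.add_monom[OF add_monom.IH, of q i j k] show ?case by (simp add: add.assoc)
qed

lemma rat_poly3_mult_monom:
  assumes "rat_poly3 f"
  shows "rat_poly3 (\<lambda>x y z. f x y z * (of_rat q * x ^ i * y ^ j * z ^ k))"
  using assms
proof (induction rule: rat_poly3.induct)
  case zero
  then show ?case using rat_poly3.zero by simp
next
  case (add_monom f q' i' j' k')
  from rat_poly3.add_monom[OF add_monom.IH, of "q * q'" "i + i'" "j + j'" "k + k'"] show ?case
    by (simp add: algebra_simps power_add of_rat_mult)
qed

lemma rat_poly3_mult:
  assumes "rat_poly3 f" "rat_poly3 g"
  shows "rat_poly3 (\<lambda>x y z. f x y z * g x y z)"
  using assms(2)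
proof (induction rule: rat_poly3.induct)
  case zero
  then show ?case using rat_poly3.zero by simp
next
  case (add_monom g q i j k)
  from rat_poly3_add[OF add_monom.IH rat_poly3_mult_monom[OF assms(1), of q i j k]] show ?case
    by (simp add: distrib_left)
qed

lemma rat_poly3_power: "rat_poly3 f \<Longrightarrow> rat_poly3 (\<lambda>x y z. f x y z ^ n)"
proof (induction n)
  case 0
  show ?case using rat_poly3_one by simp
next
  case (Suc n)
  from rat_poly3_mult[OF Suc.prems Suc.IH[OF Suc.prems]] show ?case by simp
qed

lemma rat_poly3_uminus: "rat_poly3 f \<Longrightarrow> rat_poly3 (\<lambda>x y z. - f x y z)"
  using rat_poly3_mult[OF rat_poly3_of_rat[of "-1"], of f] by (simp add: of_rat_minus)

lemma rat_poly3_diff: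
  "\<lbrakk>rat_poly3 f; rat_poly3 g\<rbrakk> \<Longrightarrow> rat_poly3 (\<lambda>x y z. f x y z - g x y z)"
  using rat_poly3_add[of f "\<lambda>x y z. - g x y z"] rat_poly3_uminus[of g] by simp

lemmas rat_poly3_intros =
  rat_poly3.zero rat_poly3_of_rat rat_poly3_one rat_poly3_vars
  rat_poly3_add rat_poly3_diff rat_poly3_uminus rat_poly3_mult rat_poly3_power

lemma rat_poly3_coefficients:
  assumes "rat_poly3 f"
  shows "\<exists>c :: nat \<times> nat \<times> nat \<Rightarrow> rat. finite {e. c e \<noteq> 0} \<and>
    (\<forall>x y z. f x y z = (\<Sum>(i,j,k)\<in>{e. c e \<noteq> 0}. of_rat (c (i,j,k)) * x ^ i * y ^ j * z ^ k))"
  using assms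
proof (induction rule: rat_poly3.induct)
  case zero
  show ?case by (rule exI[of _ "\<lambda>_. 0"]) simp
next
  case (add_monom f q i j k)
  then obtain c :: "nat \<times> nat \<times> nat \<Rightarrow> rat" where c: "finite {e. c e \<noteq> 0}"
    "\<And>x y z. f x y z = (\<Sum>(i,j,k)\<in>{e. c e \<noteq> 0}. of_rat (c (i,j,k)) * x ^ i * y ^ j * z ^ k)"
    by blast
  define c' where "c' = c((i, j, k) := c (i, j, k) + q)"
  define S where "S = insert (i, j, k) {e. c e \<noteq> 0}"
  have S: "finite S" "{e. c e \<noteq> 0} \<subseteq> S" "{e. c' e \<noteq> 0} \<subseteq> S" "(i, j, k) \<in> S"
    using c(1) by (auto simp: S_def c'_def)
  have "f x y z + of_rat q * x ^ i * y ^ j * z ^ k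
      = (\<Sum>(i,j,k)\<in>{e. c' e \<noteq> 0}. of_rat (c' (i,j,k)) * x ^ i * y ^ j * z ^ k)" for x y z
  proof -
    let ?m = "\<lambda>(i, j, k). x ^ i * y ^ j * z ^ k"
    have "(\<Sum>(i,j,k)\<in>{e. c e \<noteq> 0}. of_rat (c (i,j,k)) * x ^ i * y ^ j * z ^ k)
        = (\<Sum>e\<in>S. of_rat (c e) * ?m e)"
      by (rule sum.mono_neutral_cong_left[OF S(1,2)]) (auto simp: mult.assoc)
    moreover have "(\<Sum>(i,j,k)\<in>{e. c' e \<noteq> 0}. of_rat (c' (i,j,k)) * x ^ i * y ^ j * z ^ k)
        = (\<Sum>e\<in>S. of_rat (c' e) * ?m e)"
      by (rule sum.mono_neutral_cong_left[OF S(1,3)]) (auto simp: mult.assoc)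
    moreover have "(\<Sum>e\<in>S. of_rat (c' e) * ?m e)
        = (\<Sum>e\<in>S. of_rat (c e) * ?m e + (if e = (i, j, k) then of_rat q * ?m (i, j, k) else 0))"
      by (rule sum.cong) (auto simp: c'_def of_rat_add algebra_simps)
    ultimately show ?thesis
      using S(1,4) by (simp add: c(2) sum.distrib mult.assoc)
  qed
  moreover have "finite {e. c' e \<noteq> 0}" using S finite_subset by blast
  ultimately show ?case by blast
qed

lemma alg_indep3_rat_poly3_eq_0:
  assumes "alg_indep3 x y z" "rat_poly3 f" "f x y z = 0"
  shows "f a b c = 0"
proof -
  obtain e :: "nat \<times> nat \<times> nat \<Rightarrow> rat" where e: "finite {s. e s \<noteq> 0}"
    "\<And>x y z. f x y z = (\<Sum>(i,j,k)\<in>{s. e s \<noteq> 0}. of_rat (e (i,j,k)) * x ^ i * y ^ j * z ^ k)"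
    using rat_poly3_coefficients[OF assms(2)] by blast
  have "(\<Sum>(i,j,k)\<in>{s. e s \<noteq> 0}. of_rat (e (i,j,k)) * x ^ i * y ^ j * z ^ k) = 0"
    using assms(3) unfolding e(2) .
  then have "\<forall>s. e s = 0" using assms(1) e(1) unfolding alg_indep3_def by blast
  then show ?thesis by (simp add: e(2))
qed

lemma alg_indep3_nonzero:
  assumes "alg_indep3 x y z"
  shows "x \<noteq> 0" "y \<noteq> 0" "z \<noteq> 0"
  using alg_indep3_rat_poly3_eq_0[OF assms rat_poly3_vars(1), of 1]
    alg_indep3_rat_poly3_eq_0[OF assms rat_poly3_vars(2), of 1]
    alg_indep3_rat_poly3_eq_0[OF assms rat_poly3_vars(3), of 1] by auto

definition nondegenerate :: "complex \<Rightarrow> complex \<Rightarrow> bool" where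
  "nondegenerate d e \<longleftrightarrow> d \<noteq> 0 \<and> e \<noteq> 0 \<and> d + e \<noteq> 0"

text \<open>Here \<open>d\<close> and \<open>e\<close> are two consecutive edge vectors, and \<open>Im (d * cnj e)\<close> is, up to
  sign, twice the area, whose square is a polynomial in the edge lengths (Heron).\<close>

definition tri_fun :: "(complex \<Rightarrow> complex \<Rightarrow> complex) \<Rightarrow> bool" where
  "tri_fun F \<longleftrightarrow> (\<exists>A B n. rat_poly3 A \<and> rat_poly3 B \<and>
     (\<forall>d e. nondegenerate d e \<longrightarrow>
        of_real (cmod d * cmod e * cmod (d + e)) ^ n * F d e
        = Complex (A (cmod d) (cmod e) (cmod (d + e)))
            (Im (d * cnj e) * B (cmod d) (cmod e) (cmod (d + e)))))"

lemma tri_funI: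
  assumes "rat_poly3 A" "rat_poly3 B"
    "\<And>d e. nondegenerate d e \<Longrightarrow>
        of_real (cmod d * cmod e * cmod (d + e)) ^ n * F d e
        = Complex (A (cmod d) (cmod e) (cmod (d + e)))
            (Im (d * cnj e) * B (cmod d) (cmod e) (cmod (d + e)))"
  shows "tri_fun F"
  using assms unfolding tri_fun_def by blast

lemma tri_fun_cong:
  assumes "tri_fun F" "\<And>d e. nondegenerate d e \<Longrightarrow> F d e = G d e"
  shows "tri_fun G"
  using assms unfolding tri_fun_def by simp

lemma Re_mult_cnj_lengths:
  "Re (d * cnj e) = ((cmod (d + e))\<^sup>2 - (cmod d)\<^sup>2 - (cmod e)\<^sup>2) / 2"
  unfolding cmod_power2 by (simp add: power2_eq_square algebra_simps)

definition heron :: "real \<Rightarrow> real \<Rightarrow> real \<Rightarrow> real" where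
  "heron x y z = (x * y)\<^sup>2 - (of_rat (1/2) * (z\<^sup>2 - x\<^sup>2 - y\<^sup>2))\<^sup>2"

lemma rat_poly3_heron: "rat_poly3 heron"
  unfolding heron_def by (intro rat_poly3_intros)

lemma heron_eq: "(Im (d * cnj e))\<^sup>2 = heron (cmod d) (cmod e) (cmod (d + e))"
proof -
  have "(Re (d * cnj e))\<^sup>2 + (Im (d * cnj e))\<^sup>2 = (cmod d * cmod e)\<^sup>2"
    unfolding cmod_power2[symmetric] by (simp add: norm_mult)
  then show ?thesis
    unfolding heron_def Re_mult_cnj_lengths by (simp add: of_rat_divide)
qed

lemma tri_fun_of_real:
  assumes "rat_poly3 A"
  shows "tri_fun (\<lambda>d e. of_real (A (cmod d) (cmod e) (cmod (d + e))))"
  by (rule tri_funI[OF assms rat_poly3.zero, where n = 0]) (simp add: complex_eq_iff)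

lemma tri_fun_of_int: "tri_fun (\<lambda>d e. of_int k)"
  using tri_fun_of_real[OF rat_poly3_of_rat[of "of_int k"]] by simp

lemma tri_fun_mult_cnj: "tri_fun (\<lambda>d e. d * cnj e)"
proof (rule tri_funI[where n = 0])
  show "rat_poly3 (\<lambda>x y z. of_rat (1/2) * (z\<^sup>2 - x\<^sup>2 - y\<^sup>2))" "rat_poly3 (\<lambda>x y z. 1)"
    by (intro rat_poly3_intros)+
  show "of_real (cmod d * cmod e * cmod (d + e)) ^ 0 * (d * cnj e)
      = Complex (of_rat (1/2) * ((cmod (d + e))\<^sup>2 - (cmod d)\<^sup>2 - (cmod e)\<^sup>2)) (Im (d * cnj e) * 1)" for d e
    unfolding complex_eq_iff using Re_mult_cnj_lengths[of d e] by (simp add: of_rat_divide)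
qed

lemma tri_fun_inverse:
  "tri_fun (\<lambda>d e. inverse (of_real (cmod d * cmod e * cmod (d + e))))"
  by (rule tri_funI[OF rat_poly3_one rat_poly3.zero, where n = 1])
    (simp add: nondegenerate_def Complex_eq del: of_real_mult)

lemma tri_fun_cnj:
  assumes "tri_fun F"
  shows "tri_fun (\<lambda>d e. cnj (F d e))"
proof -
  obtain A B n where *: "rat_poly3 A" "rat_poly3 B"
    "\<And>d e. nondegenerate d e \<Longrightarrow>
        of_real (cmod d * cmod e * cmod (d + e)) ^ n * F d e
        = Complex (A (cmod d) (cmod e) (cmod (d + e)))
            (Im (d * cnj e) * B (cmod d) (cmod e) (cmod (d + e)))"
    using assms unfolding tri_fun_def by blast
  show ?thesis
  proof (rule tri_funI[OF *(1) rat_poly3_uminus[OF *(2)], where n = n])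
    fix d e assume "nondegenerate d e"
    from arg_cong[OF *(3)[OF this], of cnj]
    show "of_real (cmod d * cmod e * cmod (d + e)) ^ n * cnj (F d e)
        = Complex (A (cmod d) (cmod e) (cmod (d + e)))
            (Im (d * cnj e) * - B (cmod d) (cmod e) (cmod (d + e)))"
      by (simp add: complex_cnj)
  qed
qed

lemma tri_fun_add:
  assumes "tri_fun F" "tri_fun G"
  shows "tri_fun (\<lambda>d e. F d e + G d e)"
proof -
  obtain A B n where F: "rat_poly3 A" "rat_poly3 B"
    "\<And>d e. nondegenerate d e \<Longrightarrow>
        of_real (cmod d * cmod e * cmod (d + e)) ^ n * F d e
        = Complex (A (cmod d) (cmod e) (cmod (d + e)))
            (Im (d * cnj e) * B (cmod d) (cmod e) (cmod (d + e)))"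
    using assms unfolding tri_fun_def by blast
  obtain A' B' n' where G: "rat_poly3 A'" "rat_poly3 B'"
    "\<And>d e. nondegenerate d e \<Longrightarrow>
        of_real (cmod d * cmod e * cmod (d + e)) ^ n' * G d e
        = Complex (A' (cmod d) (cmod e) (cmod (d + e)))
            (Im (d * cnj e) * B' (cmod d) (cmod e) (cmod (d + e)))"
    using assms unfolding tri_fun_def by blast
  show ?thesis
  proof (rule tri_funI[where n = "n + n'"])
    show "rat_poly3 (\<lambda>x y z. (x * y * z) ^ n' * A x y z + (x * y * z) ^ n * A' x y z)"
      "rat_poly3 (\<lambda>x y z. (x * y * z) ^ n' * B x y z + (x * y * z) ^ n * B' x y z)"
      by (intro rat_poly3_intros F G)+
    fix d e assume nd: "nondegenerate d e"
    let ?l = "cmod d * cmod e * cmod (d + e)"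
    have "of_real ?l ^ (n + n') * (F d e + G d e)
       = of_real (?l ^ n') * (of_real ?l ^ n * F d e) + of_real (?l ^ n) * (of_real ?l ^ n' * G d e)"
      by (simp add: power_add algebra_simps)
    also have "\<dots> = Complex (?l ^ n' * A (cmod d) (cmod e) (cmod (d + e))
          + ?l ^ n * A' (cmod d) (cmod e) (cmod (d + e)))
        (Im (d * cnj e) * (?l ^ n' * B (cmod d) (cmod e) (cmod (d + e))
          + ?l ^ n * B' (cmod d) (cmod e) (cmod (d + e))))"
      unfolding F(3)[OF nd] G(3)[OF nd]
      by (simp add: complex_eq_iff algebra_simps del: of_real_power of_real_mult)
    finally show "of_real ?l ^ (n + n') * (F d e + G d e) = \<dots>" .
  qed
qed

lemma tri_fun_mult:
  assumes "tri_fun F" "tri_fun G"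
  shows "tri_fun (\<lambda>d e. F d e * G d e)"
proof -
  obtain A B n where F: "rat_poly3 A" "rat_poly3 B"
    "\<And>d e. nondegenerate d e \<Longrightarrow>
        of_real (cmod d * cmod e * cmod (d + e)) ^ n * F d e
        = Complex (A (cmod d) (cmod e) (cmod (d + e)))
            (Im (d * cnj e) * B (cmod d) (cmod e) (cmod (d + e)))"
    using assms unfolding tri_fun_def by blast
  obtain A' B' n' where G: "rat_poly3 A'" "rat_poly3 B'"
    "\<And>d e. nondegenerate d e \<Longrightarrow>
        of_real (cmod d * cmod e * cmod (d + e)) ^ n' * G d e
        = Complex (A' (cmod d) (cmod e) (cmod (d + e)))
            (Im (d * cnj e) * B' (cmod d) (cmod e) (cmod (d + e)))"
    using assms unfolding tri_fun_def by blast
  show ?thesis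
  proof (rule tri_funI[where n = "n + n'"])
    show "rat_poly3 (\<lambda>x y z. A x y z * A' x y z - heron x y z * (B x y z * B' x y z))"
      "rat_poly3 (\<lambda>x y z. A x y z * B' x y z + B x y z * A' x y z)"
      by (intro rat_poly3_intros rat_poly3_heron F G)+
    fix d e assume nd: "nondegenerate d e"
    let ?l = "cmod d * cmod e * cmod (d + e)" and ?w = "Im (d * cnj e)"
    define a b a' b' where "a = A (cmod d) (cmod e) (cmod (d + e))"
      and "b = B (cmod d) (cmod e) (cmod (d + e))" and "a' = A' (cmod d) (cmod e) (cmod (d + e))"
      and "b' = B' (cmod d) (cmod e) (cmod (d + e))"
    have "of_real ?l ^ (n + n') * (F d e * G d e)
        = (of_real ?l ^ n * F d e) * (of_real ?l ^ n' * G d e)"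
      by (simp add: power_add algebra_simps)
    also have "\<dots> = Complex (a * a' - ?w\<^sup>2 * (b * b')) (?w * (a * b' + b * a'))"
      unfolding F(3)[OF nd] G(3)[OF nd] a_def[symmetric] b_def[symmetric]
        a'_def[symmetric] b'_def[symmetric]
      by (simp add: complex_eq_iff power2_eq_square algebra_simps)
    finally show "of_real ?l ^ (n + n') * (F d e * G d e)
        = Complex (a * a' - heron (cmod d) (cmod e) (cmod (d + e)) * (b * b')) (?w * (a * b' + b * a'))"
      by (simp only: heron_eq)
  qed
qed

lemma tri_fun_sum:
  assumes "finite S" "\<And>s. s \<in> S \<Longrightarrow> tri_fun (F s)"
  shows "tri_fun (\<lambda>d e. \<Sum>s\<in>S. F s d e)"
  using assms
proof (induction rule: finite_induct)
  case empty
  then show ?case using tri_fun_of_int[of 0] by simp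
next
  case (insert s S)
  then have "tri_fun (\<lambda>d e. F s d e + (\<Sum>s\<in>S. F s d e))" by (intro tri_fun_add) auto
  then show ?case using insert.hyps by simp
qed

lemma tri_fun_power: "tri_fun F \<Longrightarrow> tri_fun (\<lambda>d e. F d e ^ n)"
proof (induction n)
  case 0
  show ?case using tri_fun_of_int[of 1] by simp
next
  case (Suc n)
  from tri_fun_mult[OF Suc.prems Suc.IH[OF Suc.prems]] show ?case by simp
qed

lemma tri_fun_power_int:
  assumes "tri_fun F" "\<And>d e. nondegenerate d e \<Longrightarrow> cmod (F d e) = 1"
  shows "tri_fun (\<lambda>d e. F d e powi k)"
proof (cases "k \<ge> 0")
  case True
  then show ?thesis using tri_fun_power[OF assms(1), of "nat k"] by (simp add: power_int_def)
next
  case False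
  have "inverse (F d e) = cnj (F d e)" if "nondegenerate d e" for d e
  proof -
    have "F d e * cnj (F d e) = 1" using assms(2)[OF that] by (metis complex_norm_square of_real_1 one_power2)
    then show ?thesis by (rule inverse_unique)
  qed
  then show ?thesis
    using False tri_fun_power[OF tri_fun_cnj[OF assms(1)], of "nat (- k)"]
    by (elim tri_fun_cong) (simp add: power_int_def)
qed

lemma tri_fun_zero_propagates:
  assumes "tri_fun F" "alg_indep3 (cmod d) (cmod e) (cmod (d + e))" "F d e = 0"
    and "nondegenerate d' e'"
  shows "F d' e' = 0"
proof -
  obtain A B n where F: "rat_poly3 A" "rat_poly3 B"
    "\<And>d e. nondegenerate d e \<Longrightarrow>
        of_real (cmod d * cmod e * cmod (d + e)) ^ n * F d e
        = Complex (A (cmod d) (cmod e) (cmod (d + e)))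
            (Im (d * cnj e) * B (cmod d) (cmod e) (cmod (d + e)))"
    using assms unfolding tri_fun_def by blast
  define R where "R x y z = (A x y z)\<^sup>2 + heron x y z * (B x y z)\<^sup>2" for x y z
  have R: "rat_poly3 R"
    unfolding R_def by (intro rat_poly3_intros rat_poly3_heron F)
  have R_eq: "R (cmod d) (cmod e) (cmod (d + e)) = (A (cmod d) (cmod e) (cmod (d + e)))\<^sup>2
      + (Im (d * cnj e) * B (cmod d) (cmod e) (cmod (d + e)))\<^sup>2" for d e
    unfolding R_def heron_eq[symmetric] by (simp only: power_mult_distrib)
  have "nondegenerate d e"
    using alg_indep3_nonzero[OF assms(2)] by (auto simp: nondegenerate_def)
  then have "R (cmod d) (cmod e) (cmod (d + e)) = 0"
    using F(3)[of d e] assms(3) unfolding R_eq sum_power2_eq_zero_iff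
    by (metis complex.inject mult_zero_right zero_complex.code)
  then have "R (cmod d') (cmod e') (cmod (d' + e')) = 0"
    using alg_indep3_rat_poly3_eq_0[OF assms(2) R] by blast
  then have "of_real (cmod d' * cmod e' * cmod (d' + e')) ^ n * F d' e' = 0"
    unfolding F(3)[OF assms(4)] R_eq sum_power2_eq_zero_iff by (metis zero_complex.code)
  then show ?thesis using assms(4) by (auto simp: nondegenerate_def)
qed

subsection \<open>Independence of the linear parts\<close>

definition laurent_eval :: "complex \<Rightarrow> complex \<Rightarrow> (int \<times> int \<Rightarrow>\<^sub>0 int) \<Rightarrow> complex" where
  "laurent_eval u v f = (\<Sum>(n, m)\<in>Poly_Mapping.keys f.
     of_int (Poly_Mapping.lookup f (n, m)) * (u powi n * v powi m))"

definition laurent_independent :: "complex \<Rightarrow> complex \<Rightarrow> bool" where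
  "laurent_independent u v \<longleftrightarrow> (\<forall>f. laurent_eval u v f = 0 \<longrightarrow> f = 0)"

lemma laurent_eval_superset:
  assumes "finite S" "Poly_Mapping.keys f \<subseteq> S"
  shows "laurent_eval u v f = (\<Sum>(n, m)\<in>S.
     of_int (Poly_Mapping.lookup f (n, m)) * (u powi n * v powi m))"
  unfolding laurent_eval_def
  by (rule sum.mono_neutral_left[OF assms]) (auto simp: in_keys_iff)

lemma laurent_eval_frag_of: "laurent_eval u v (frag_of (n, m)) = u powi n * v powi m"
  by (simp add: laurent_eval_def)

lemma laurent_eval_diff: "laurent_eval u v (f - g) = laurent_eval u v f - laurent_eval u v g"
proof -
  let ?S = "Poly_Mapping.keys f \<union> Poly_Mapping.keys g"
  have "Poly_Mapping.keys (f - g) \<subseteq> ?S" by (rule keys_diff)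
  then have "laurent_eval u v (f - g) = (\<Sum>(n, m)\<in>?S.
      of_int (Poly_Mapping.lookup (f - g) (n, m)) * (u powi n * v powi m))"
    by (intro laurent_eval_superset) auto
  moreover have "laurent_eval u v h = (\<Sum>(n, m)\<in>?S.
      of_int (Poly_Mapping.lookup h (n, m)) * (u powi n * v powi m))" if "h \<in> {f, g}" for h
    using that by (intro laurent_eval_superset) auto
  ultimately show ?thesis
    by (simp add: lookup_minus left_diff_distrib sum_subtractf case_prod_unfold)
qed

lemma laurent_polynomial_zero:
  fixes a :: "int \<Rightarrow> complex"
  assumes "finite S" "infinite U" "0 \<notin> U"
    and zero: "\<And>u. u \<in> U \<Longrightarrow> (\<Sum>n\<in>S. a n * u powi n) = 0"
    and "n \<in> S"
  shows "a n = 0"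
proof -
  obtain l where l: "\<And>n. n \<in> S \<Longrightarrow> l \<le> n"
    using assms(1) bdd_below_finite[of S] by (auto simp: bdd_below_def)
  define p where "p = (\<Sum>n\<in>S. Polynomial.monom (a n) (nat (n - l)))"
  have "poly p u = 0" if "u \<in> U" for u
  proof -
    have [simp]: "u \<noteq> 0" using that assms(3) by auto
    have "poly p u = (\<Sum>n\<in>S. a n * u ^ nat (n - l))"
      by (simp add: p_def poly_sum poly_monom)
    also have "\<dots> = (\<Sum>n\<in>S. u powi (- l) * (a n * u powi n))"
    proof (rule sum.cong)
      fix n assume "n \<in> S"
      then have "u ^ nat (n - l) = u powi (n - l)" using l by (simp add: power_int_def)
      also have "\<dots> = u powi (- l) * u powi n" by (simp flip: power_int_add)
      finally show "a n * u ^ nat (n - l) = u powi (- l) * (a n * u powi n)" by simp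
    qed simp
    also have "\<dots> = 0" using zero[OF that] by (simp flip: sum_distrib_left)
    finally show ?thesis .
  qed
  then have "U \<subseteq> {u. poly p u = 0}" by blast
  then have "p = 0" using assms(2) poly_roots_finite finite_subset by blast
  moreover have "Polynomial.coeff p (nat (n - l)) = a n"
  proof -
    have "Polynomial.coeff p (nat (n - l)) = (\<Sum>k\<in>S. if k = n then a k else 0)"
      unfolding p_def coeff_sum
      by (rule sum.cong) (use l \<open>n \<in> S\<close> in \<open>auto simp: Polynomial.coeff_monom eq_nat_nat_iff\<close>)
    then show ?thesis using assms(1,5) by simp
  qed
  ultimately show ?thesis by simp
qed

lemma laurent_eval_grid_zero:
  assumes "infinite U" "0 \<notin> U" "\<And>u v. \<lbrakk>u \<in> U; v \<in> U\<rbrakk> \<Longrightarrow> laurent_eval u v f = 0"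
  shows "f = 0"
proof -
  let ?K = "Poly_Mapping.keys f"
  define S T where "S = fst ` ?K" and "T = snd ` ?K"
  have fin: "finite S" "finite T" by (simp_all add: S_def T_def)
  have eval: "laurent_eval u v f = (\<Sum>n\<in>S.
      (\<Sum>m\<in>T. of_int (Poly_Mapping.lookup f (n, m)) * v powi m) * u powi n)" for u v
  proof -
    have "?K \<subseteq> S \<times> T" unfolding S_def T_def by (rule subset_fst_snd)
    then have "laurent_eval u v f = (\<Sum>(n, m)\<in>S \<times> T.
        of_int (Poly_Mapping.lookup f (n, m)) * (u powi n * v powi m))"
      using fin by (intro laurent_eval_superset) auto
    also have "\<dots> = (\<Sum>n\<in>S. \<Sum>m\<in>T.
        of_int (Poly_Mapping.lookup f (n, m)) * (u powi n * v powi m))"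
      by (simp add: sum.cartesian_product)
    finally show ?thesis by (simp add: sum_distrib_left mult_ac)
  qed
  have "Poly_Mapping.lookup f (n, m) = 0" if "n \<in> S" "m \<in> T" for n m
  proof -
    have "(\<Sum>m\<in>T. of_int (Poly_Mapping.lookup f (n, m)) * v powi m) = (0::complex)" if "v \<in> U" for v
      by (rule laurent_polynomial_zero[OF fin(1) assms(1,2) _ \<open>n \<in> S\<close>])
        (use assms(3)[OF _ that] in \<open>simp add: eval\<close>)
    then have "of_int (Poly_Mapping.lookup f (n, m)) = (0::complex)"
      by (rule laurent_polynomial_zero[OF fin(2) assms(1,2) _ \<open>m \<in> T\<close>])
    then show ?thesis by simp
  qed
  then have "Poly_Mapping.lookup f (n, m) = 0" for n m
    by (metis S_def T_def fst_conv snd_conv image_eqI in_keys_iff)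
  then show ?thesis by (intro poly_mapping_eqI) auto
qed

definition edge_ratio :: "complex \<Rightarrow> complex \<Rightarrow> complex" where
  "edge_ratio d e = (d * cnj e) / (cnj d * e)"

lemma cmod_edge_ratio: "\<lbrakk>d \<noteq> 0; e \<noteq> 0\<rbrakk> \<Longrightarrow> cmod (edge_ratio d e) = 1"
  by (simp add: edge_ratio_def norm_mult norm_divide)

lemma edge_ratio_eq:
  assumes "d \<noteq> 0" "e \<noteq> 0"
  shows "edge_ratio d e = (d * cnj e)\<^sup>2 * (inverse (of_real (cmod d * cmod e)))\<^sup>2"
proof -
  have "(of_real (cmod d * cmod e))\<^sup>2 = (d * cnj d) * (e * cnj e)"
    by (simp add: power_mult_distrib flip: complex_norm_square)
  then show ?thesis
    using assms unfolding edge_ratio_def power_inverse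
    by (simp add: power2_eq_square divide_simps)
qed

lemma edge_ratio_scale:
  "k \<noteq> 0 \<Longrightarrow> edge_ratio (of_real k * d) (of_real k * e) = edge_ratio d e"
  by (simp add: edge_ratio_def)

lemma tri_fun_edge_ratio: "tri_fun (\<lambda>d e. edge_ratio d e)"
proof -
  have "tri_fun (\<lambda>d e. (d * cnj e)\<^sup>2 *
      (of_real (cmod (d + e)) * inverse (of_real (cmod d * cmod e * cmod (d + e))))\<^sup>2)"
    by (intro tri_fun_mult tri_fun_power tri_fun_mult_cnj tri_fun_inverse
        tri_fun_of_real[where A = "\<lambda>x y z. z"] rat_poly3_vars)
  then show ?thesis
    by (rule tri_fun_cong) (simp add: nondegenerate_def edge_ratio_eq field_simps)
qed

lemma tri_fun_edge_ratio': "tri_fun (\<lambda>d e. edge_ratio (d + e) d)"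
proof -
  have "tri_fun (\<lambda>d e. (of_real ((cmod d)\<^sup>2) + cnj (d * cnj e))\<^sup>2 *
      (of_real (cmod e) * inverse (of_real (cmod d * cmod e * cmod (d + e))))\<^sup>2)"
    by (intro tri_fun_mult tri_fun_power tri_fun_add tri_fun_cnj tri_fun_mult_cnj tri_fun_inverse
        tri_fun_of_real[where A = "\<lambda>x y z. y"] tri_fun_of_real[where A = "\<lambda>x y z. x\<^sup>2"]
        rat_poly3_vars rat_poly3_power)
  moreover have "of_real ((cmod d)\<^sup>2) + cnj (d * cnj e) = (d + e) * cnj d" for d e
    unfolding complex_norm_square by (simp add: algebra_simps)
  ultimately have "tri_fun (\<lambda>d e. ((d + e) * cnj d)\<^sup>2 *
      (of_real (cmod e) * inverse (of_real (cmod d * cmod e * cmod (d + e))))\<^sup>2)"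
    by (simp only:)
  then show ?thesis
    by (rule tri_fun_cong) (simp add: nondegenerate_def edge_ratio_eq field_simps)
qed

lemma generic_laurent_independent:
  assumes "generic_triangle A1 A2 A3"
  shows "laurent_independent (edge_ratio (A3 - A2) (A1 - A3)) (edge_ratio (A1 - A2) (A3 - A2))"
  unfolding laurent_independent_def
proof (intro allI impI)
  fix f
  assume zero: "laurent_eval (edge_ratio (A3 - A2) (A1 - A3)) (edge_ratio (A1 - A2) (A3 - A2)) f = 0"
  obtain k where k: "k > 0"
    "alg_indep3 (k * cmod (A2 - A3)) (k * cmod (A1 - A3)) (k * cmod (A1 - A2))"
    using assms unfolding generic_triangle_def by blast
  define F where "F d e = laurent_eval (edge_ratio d e) (edge_ratio (d + e) d) f" for d e
  have "tri_fun F"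
    unfolding F_def laurent_eval_def case_prod_unfold
    by (intro tri_fun_sum tri_fun_mult tri_fun_of_int tri_fun_power_int tri_fun_edge_ratio
        tri_fun_edge_ratio') (auto simp: nondegenerate_def cmod_edge_ratio)
  moreover define d e where "d = of_real k * (A3 - A2)" and "e = of_real k * (A1 - A3)"
  have de: "d + e = of_real k * (A1 - A2)" by (simp add: d_def e_def algebra_simps)
  have "alg_indep3 (cmod d) (cmod e) (cmod (d + e))"
    using k unfolding de by (simp add: d_def e_def norm_mult norm_minus_commute)
  moreover have "F d e = 0"
    using zero k(1) unfolding F_def de by (simp add: d_def e_def edge_ratio_scale)
  ultimately have F_zero: "F d' e' = 0" if "nondegenerate d' e'" for d' e'
    using tri_fun_zero_propagates that by blast
  define w where "w s = (of_real s + \<i>) / (of_real s - \<i>)" for s :: real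
  have nz: "of_real s + \<i> \<noteq> 0" "of_real s - \<i> \<noteq> 0" for s :: real
    by (simp_all add: complex_eq_iff)
  have "inj w"
  proof (rule injI)
    fix s t assume "w s = w t"
    then have "(of_real s + \<i>) * (of_real t - \<i>) = (of_real t + \<i>) * (of_real s - \<i>)"
      using nz by (simp add: w_def divide_simps)
    then have "Im ((of_real s + \<i>) * (of_real t - \<i>)) = Im ((of_real t + \<i>) * (of_real s - \<i>))"
      by (rule arg_cong)
    then show "s = t" by simp
  qed
  show "f = 0"
  proof (rule laurent_eval_grid_zero)
    show "infinite (w ` {0<..})"
      using finite_imageD[of w "{0<..}"] \<open>inj w\<close> infinite_Ioi[of "0::real"]
      by (meson inj_on_subset subset_UNIV)
    show "0 \<notin> w ` {0<..}" using nz by (auto simp: w_def)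
    fix u v assume "u \<in> w ` {0<..}" "v \<in> w ` {0<..}"
    then obtain s t where st: "u = w s" "v = w t" "s > 0" "t > 0" by auto
    define d' e' where "d' = - complex_of_real (s + t)" and "e' = of_real s - \<i>"
    have d': "d' \<noteq> 0" "cnj d' = d'" using st(3,4) by (simp_all add: d'_def flip: of_real_add)
    have sum: "d' + e' = - (of_real t + \<i>)" by (simp add: d'_def e'_def)
    have "nondegenerate d' e'"
      using d'(1) nz unfolding nondegenerate_def sum neg_equal_0_iff_equal by (simp add: e'_def)
    moreover have "edge_ratio d' e' = u"
      using d' by (simp add: edge_ratio_def e'_def st w_def)
    moreover have "edge_ratio (d' + e') d' = v"
      unfolding sum using d' minus_divide_divide[of "of_real t + \<i>" "of_real t - \<i>"]
      by (simp add: edge_ratio_def st w_def)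
    ultimately show "laurent_eval u v f = 0" using F_zero unfolding F_def by metis
  qed
qed

subsection \<open>Groups of orientation-preserving motions\<close>

definition linear_part :: "(complex \<Rightarrow> complex) \<Rightarrow> complex" where
  "linear_part f = f 1 - f 0"

lemma SE2_eq:
  assumes "f \<in> SE2"
  shows "f z = linear_part f * z + f 0" "linear_part f \<noteq> 0"
  using assms by (auto simp: SE2_def linear_part_def)

locale se2_group = group H for H :: "(complex \<Rightarrow> complex) monoid" (structure) +
  assumes carrier_subset_SE2: "carrier H \<subseteq> SE2"
    and mult_eq: "g \<otimes> h = h \<circ> g" and one_eq: "\<one> = id"
begin

lemma affine: "g \<in> carrier H \<Longrightarrow> g z = linear_part g * z + g 0"
  using SE2_eq carrier_subset_SE2 by blast

lemma linear_part_nonzero: "g \<in> carrier H \<Longrightarrow> linear_part g \<noteq> 0"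
  using SE2_eq carrier_subset_SE2 by blast

lemma linear_part_one [simp]: "linear_part \<one> = 1"
  by (simp add: linear_part_def one_eq)

lemma linear_part_mult [simp]:
  assumes "g \<in> carrier H" "h \<in> carrier H"
  shows "linear_part (g \<otimes> h) = linear_part g * linear_part h"
proof -
  have "linear_part (g \<otimes> h) = h (g 1) - h (g 0)" by (simp add: linear_part_def mult_eq)
  also have "\<dots> = linear_part h * (g 1 - g 0)"
    by (simp add: affine[OF assms(2), of "g 1"] affine[OF assms(2), of "g 0"] algebra_simps)
  finally show ?thesis by (simp add: linear_part_def)
qed

lemma linear_part_inv [simp]:
  assumes "g \<in> carrier H"
  shows "linear_part (inv g) = inverse (linear_part g)"
proof -
  have "linear_part g * linear_part (inv g) = 1"
    using assms linear_part_mult[of g "inv g"] by simp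
  then show ?thesis by (metis inverse_unique)
qed

lemma linear_part_int_pow [simp]:
  assumes "g \<in> carrier H"
  shows "linear_part (g [^] (n::int)) = linear_part g powi n"
proof -
  have nat: "linear_part (g [^] (k::nat)) = linear_part g ^ k" for k
    by (induction k) (use assms in simp_all)
  show ?thesis
  proof (cases n rule: int_cases2)
    case (nonneg k)
    then show ?thesis using nat by (simp add: int_pow_int)
  next
    case (nonpos k)
    then have "linear_part (g [^] n) = inverse (linear_part g ^ k)"
      using assms nat by (simp add: int_pow_neg int_pow_int)
    then show ?thesis by (simp add: nonpos power_int_minus)
  qed
qed

lemma linear_part_gcomm [simp]:
  "\<lbrakk>g \<in> carrier H; h \<in> carrier H\<rbrakk> \<Longrightarrow> linear_part (gcomm H g h) = 1"
  by (simp add: gcomm_def linear_part_nonzero field_simps)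

lemma linear_part_conj_by [simp]:
  "\<lbrakk>g \<in> carrier H; h \<in> carrier H\<rbrakk> \<Longrightarrow> linear_part (conj_by h g) = linear_part g"
  by (simp add: conj_by_def linear_part_nonzero)

lemma translation_eq: "\<lbrakk>g \<in> carrier H; linear_part g = 1\<rbrakk> \<Longrightarrow> g z = z + g 0"
  using affine[of g z] by simp

lemma translation_eqI:
  assumes "g \<in> carrier H" "linear_part g = 1" "g 0 = 0"
  shows "g = \<one>"
  using translation_eq[OF assms(1,2)] assms(3) by (auto simp: one_eq)

lemma translation_mult:
  assumes "g \<in> carrier H" "linear_part g = 1" "h \<in> carrier H" "linear_part h = 1"
  shows "(g \<otimes> h) 0 = g 0 + h 0"
  using translation_eq[OF assms(3,4), of "g 0"] by (simp add: mult_eq)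

lemma translations_commute:
  assumes "g \<in> carrier H" "linear_part g = 1" "h \<in> carrier H" "linear_part h = 1"
  shows "g \<otimes> h = h \<otimes> g"
proof
  fix z
  show "(g \<otimes> h) z = (h \<otimes> g) z"
    using translation_eq[OF assms(1,2), of "h z"] translation_eq[OF assms(3,4), of "g z"]
      translation_eq[OF assms(1,2), of z] translation_eq[OF assms(3,4), of z]
    by (simp add: mult_eq)
qed

lemma translation_conj_by:
  assumes "g \<in> carrier H" "linear_part g = 1" "h \<in> carrier H"
  shows "conj_by h g 0 = linear_part h * g 0"
proof -
  have "h \<otimes> conj_by h g = g \<otimes> h"
    using assms by (simp add: conj_by_def word_simps)
  then have "conj_by h g (h 0) = h (g 0)" by (metis comp_apply mult_eq)
  moreover have "conj_by h g (h 0) = h 0 + conj_by h g 0"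
    using assms by (intro translation_eq) auto
  ultimately show ?thesis using affine[OF assms(3), of "g 0"] by simp
qed

lemma tri_relations_hold:
  assumes "x \<in> carrier H" "y \<in> carrier H"
  shows "tri_relations_hold H x y"
proof -
  have "tri_relator H x y n m = \<one>" for n m
  proof -
    let ?w = "x [^] n \<otimes> y [^] m"
    have "gcomm H (gcomm H x y) (conj_by ?w (gcomm H x y)) = \<one>"
      using assms by (simp add: gcomm_eq_one_iff translations_commute)
    then show ?thesis by (simp add: tri_relator_def conj_by_def Let_def)
  qed
  then show ?thesis by (simp add: tri_relations_hold_def)
qed

lemma faithful_normal_form:
  assumes xy: "x \<in> carrier H" "y \<in> carrier H" "gcomm H x y \<noteq> \<one>"
    and indep: "laurent_independent (linear_part x) (linear_part y)"
    and \<Phi>: "\<Phi> \<in> hom (free_Abelian_group UNIV) H"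
      "\<And>n m. \<Phi> (frag_of (n, m)) = tri_relations.C H x y n m"
    and one: "x [^] (p::int) \<otimes> y [^] (q::int) \<otimes> \<Phi> f = \<one>"
  shows "p = 0 \<and> q = 0 \<and> f = 0"
proof -
  interpret tri_relations H x y
    using xy tri_relations_hold by (simp add: tri_relations_def tri_relations_axioms_def is_group)
  interpret \<Phi>: group_hom "free_Abelian_group UNIV" H \<Phi>
    by (simp add: \<Phi>(1) group_hom_axioms_def group_hom_def is_group)
  let ?u = "linear_part x" and ?v = "linear_part y"
  define \<tau> where "\<tau> = c 0"
  have c: "linear_part c = 1" by (simp add: c_def)
  have "\<tau> \<noteq> 0"
    using translation_eqI[OF c_closed c] xy(3) by (auto simp: \<tau>_def c_def)
  have C: "linear_part (C n m) = 1" "C n m 0 = ?u powi n * ?v powi m * \<tau>" for n m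
    using c by (simp_all add: C_def translation_conj_by \<tau>_def)
  have closed: "\<Phi> f \<in> carrier H" for f
    using \<Phi>.hom_closed[of f] by simp
  have \<Phi>_diff: "\<Phi> (f - g) = \<Phi> f \<otimes> inv \<Phi> g" for f g
  proof -
    have "\<Phi> (f - g) = \<Phi> f \<otimes> \<Phi> (- g)" using \<Phi>.hom_mult[of f "- g"] by simp
    then show ?thesis using \<Phi>.hom_inv[of g] by simp
  qed
  have \<Phi>_trans: "linear_part (\<Phi> f) = 1 \<and> \<Phi> f 0 = laurent_eval ?u ?v f * \<tau>" for f
    using subset_UNIV[of "Poly_Mapping.keys f"]
  proof (induction f rule: frag_induction)
    case zero
    show ?case using \<Phi>.hom_one by (simp add: one_eq laurent_eval_def linear_part_def)
  next
    case (one s)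
    then show ?case by (cases s) (simp add: \<Phi>(2) C laurent_eval_frag_of)
  next
    case (diff f g)
    have "\<Phi> (f - g) \<otimes> \<Phi> g = \<Phi> f" using closed by (simp add: \<Phi>_diff m_assoc)
    moreover have lin: "linear_part (\<Phi> (f - g)) = 1" using diff.IH closed by (simp add: \<Phi>_diff)
    ultimately have "\<Phi> (f - g) 0 + \<Phi> g 0 = \<Phi> f 0"
      using translation_mult[of "\<Phi> (f - g)" "\<Phi> g"] diff.IH closed by simp
    then have "\<Phi> (f - g) 0 = (laurent_eval ?u ?v f - laurent_eval ?u ?v g) * \<tau>"
      using diff.IH by (simp add: algebra_simps eq_diff_eq)
    then show ?case using lin by (simp add: laurent_eval_diff)
  qed
  have "linear_part (x [^] p \<otimes> y [^] q \<otimes> \<Phi> f) = 1" by (simp add: one)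
  then have "?u powi p * ?v powi q = 1"
    using \<Phi>_trans closed by simp
  then have "laurent_eval ?u ?v (frag_of (p, q) - frag_of (0, 0)) = 0"
    by (simp add: laurent_eval_diff laurent_eval_frag_of)
  then have "frag_of (p, q) - frag_of (0, 0) = (0 :: int \<times> int \<Rightarrow>\<^sub>0 int)"
    using indep unfolding laurent_independent_def by blast
  then have pq: "p = 0" "q = 0" by (simp_all add: frag_of_eq)
  then have "\<Phi> f = \<one>" using one closed by simp
  then have "\<Phi> f 0 = 0" by (simp add: one_eq)
  then have "laurent_eval ?u ?v f = 0" using \<Phi>_trans \<open>\<tau> \<noteq> 0\<close> by simp
  then show ?thesis using pq indep unfolding laurent_independent_def by blast
qed

lemma tri_presentation:
  assumes "x \<in> carrier H" "y \<in> carrier H" "gcomm H x y \<noteq> \<one>" "carrier H = generate H {x, y}"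
    and "laurent_independent (linear_part x) (linear_part y)"
  shows "tri_presentation H x y TYPE(('k, 'm) monoid_scheme)"
  unfolding tri_presentation_def
proof (intro conjI allI impI)
  fix K :: "('k, 'm) monoid_scheme" and b2 b3
  assume K: "group K \<and> b2 \<in> carrier K \<and> b3 \<in> carrier K \<and> tri_relations_hold K b2 b3"
  show "\<exists>h\<in>hom H K. h x = b2 \<and> h y = b3"
  proof (rule presentation_hom_exists)
    fix p q \<Phi> f
    assume "\<Phi> \<in> hom (free_Abelian_group UNIV) H"
      "\<And>n m. \<Phi> (frag_of (n, m)) = tri_relations.C H x y n m"
      "x [^] (p::int) \<otimes> y [^] (q::int) \<otimes> \<Phi> f = \<one>"
    then show "p = 0 \<and> q = 0 \<and> f = 0"
      by (rule faithful_normal_form[OF assms(1-3,5)])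
  qed (fact assms is_group tri_relations_hold[OF assms(1,2)] | use K in blast)+
qed (fact assms is_group tri_relations_hold[OF assms(1,2)])+

end

subsection \<open>The triangle group\<close>

lemma plane_perm_group_simps [simp]:
  "carrier plane_perm_group = {f. bij f}"
  "g \<otimes>\<^bsub>plane_perm_group\<^esub> h = h \<circ> g"
  "\<one>\<^bsub>plane_perm_group\<^esub> = id"
  by (simp_all add: plane_perm_group_def)

lemma group_plane_perm_group: "group plane_perm_group"
proof (rule groupI)
  fix f assume "f \<in> carrier plane_perm_group"
  then show "\<exists>g\<in>carrier plane_perm_group. g \<otimes>\<^bsub>plane_perm_group\<^esub> f = \<one>\<^bsub>plane_perm_group\<^esub>"
    by (intro bexI[of _ "inv_into UNIV f"]) (auto simp: bij_imp_bij_inv fun_eq_iff bij_is_surj surj_f_inv_f)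
qed (auto simp: bij_comp comp_assoc)

interpretation plane: group plane_perm_group
  by (rule group_plane_perm_group)

lemma SE2I: "\<lbrakk>norm a = 1; \<And>z. f z = a * z + b\<rbrakk> \<Longrightarrow> f \<in> SE2"
  unfolding SE2_def by blast

lemma bij_SE2:
  assumes "f \<in> SE2"
  shows "bij f"
proof -
  obtain a b where ab: "norm a = 1" "f = (\<lambda>z. a * z + b)" using assms by (auto simp: SE2_def)
  then have "a \<noteq> 0" by auto
  then show ?thesis
    unfolding ab(2) by (intro bij_betw_byWitness[where f' = "\<lambda>z. (z - b) / a"]) auto
qed

lemma subgroup_SE2: "subgroup SE2 plane_perm_group"
proof (rule plane.subgroupI)
  show "SE2 \<subseteq> carrier plane_perm_group" using bij_SE2 by auto
  have "id \<in> SE2" by (rule SE2I[of 1 _ 0]) simp_all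
  then show "SE2 \<noteq> {}" by blast
next
  fix f assume f: "f \<in> SE2"
  then obtain a b where ab: "norm a = 1" "f = (\<lambda>z. a * z + b)" by (auto simp: SE2_def)
  then have "a \<noteq> 0" by auto
  define g where "g z = inverse a * z + (- inverse a * b)" for z
  have g: "g \<in> SE2"
    by (rule SE2I[of "inverse a" _ "- inverse a * b"]) (simp_all add: g_def ab(1) norm_inverse)
  have "f \<circ> g = id" using \<open>a \<noteq> 0\<close> by (simp add: fun_eq_iff g_def ab algebra_simps)
  then have "inv\<^bsub>plane_perm_group\<^esub> f = g"
    using f g bij_SE2 by (intro plane.inv_equality) simp_all
  then show "inv\<^bsub>plane_perm_group\<^esub> f \<in> SE2" using g by simp
next
  fix f g assume "f \<in> SE2" "g \<in> SE2"
  then obtain a b a' b' where "norm a = 1" "f = (\<lambda>z. a * z + b)" "norm a' = 1" "g = (\<lambda>z. a' * z + b')"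
    unfolding SE2_def by blast
  then show "f \<otimes>\<^bsub>plane_perm_group\<^esub> g \<in> SE2"
    by (intro SE2I[of "a' * a" _ "a' * b + b'"]) (simp_all add: norm_mult algebra_simps)
qed

lemma refl_line_eq:
  "p \<noteq> q \<Longrightarrow> refl_line p q z = p + (q - p) / cnj (q - p) * cnj (z - p)"
  by (simp add: refl_line_def)

lemma refl_line_involution:
  assumes "p \<noteq> q"
  shows "refl_line p q \<circ> refl_line p q = id"
proof
  fix z
  show "(refl_line p q \<circ> refl_line p q) z = id z"
    using assms by (simp add: refl_line_def)
qed

lemma bij_refl_line: "p \<noteq> q \<Longrightarrow> bij (refl_line p q)"
  using refl_line_involution by (metis o_bij)

lemma inv_refl_line:
  "p \<noteq> q \<Longrightarrow> inv\<^bsub>plane_perm_group\<^esub> refl_line p q = refl_line p q"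
  by (rule plane.inv_equality) (simp_all add: refl_line_involution bij_refl_line)

lemma refl_line_not_SE2:
  assumes "p \<noteq> q"
  shows "refl_line p q \<notin> SE2"
proof
  assume "refl_line p q \<in> SE2"
  then obtain a b where ab: "refl_line p q = (\<lambda>z. a * z + b)" by (auto simp: SE2_def)
  define s where "s = (q - p) / cnj (q - p)"
  have s: "s \<noteq> 0" using assms by (simp add: s_def)
  have *: "p + s * cnj (z - p) = a * z + b" for z
    using fun_cong[OF ab, of z] unfolding refl_line_eq[OF assms] s_def .
  have "a = s" using *[of 0] *[of 1] by (simp add: algebra_simps)
  moreover have "a * \<i> = (a * \<i> + b) - (a * 0 + b)" by simp
  then have "a * \<i> = - s * \<i>" unfolding *[symmetric] by (simp add: algebra_simps)
  ultimately show False using s by (simp add: complex_eq_iff)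
qed

lemma refl_line_comp:
  assumes "p \<noteq> q" "q \<noteq> r"
  shows "refl_line p q \<circ> refl_line q r = (\<lambda>z. q + edge_ratio (q - p) (r - q) * (z - q))"
proof
  fix z
  define d e where "d = q - p" and "e = r - q"
  have "d \<noteq> 0" "e \<noteq> 0" using assms by (simp_all add: d_def e_def)
  moreover have "p = q - d" "r = q + e" by (simp_all add: d_def e_def)
  ultimately show "(refl_line p q \<circ> refl_line q r) z = q + edge_ratio (q - p) (r - q) * (z - q)"
    by (simp add: refl_line_def edge_ratio_def divide_simps algebra_simps)
qed

lemma (in group) involutions_even_or_odd:
  assumes r: "r1 \<in> carrier G" "r2 \<in> carrier G" "r3 \<in> carrier G"
    and inv: "inv r1 = r1" "inv r2 = r2" "inv r3 = r3"
    and g: "g \<in> generate G {r1, r2, r3}"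
  shows "\<exists>s\<in>generate G {r2 \<otimes> r1, r1 \<otimes> r3}. g = s \<or> g = r1 \<otimes> s"
proof -
  let ?A = "{r2 \<otimes> r1, r1 \<otimes> r3}"
  let ?S = "generate G ?A"
  have sq [simp]: "r1 \<otimes> r1 = \<one>" "r1 \<otimes> (r1 \<otimes> a) = a" if "a \<in> carrier G" for a
    using r inv that by (metis r_inv, metis inv_mult_cancel_left)
  have A: "?A \<subseteq> carrier G" using r by auto
  note in_carrier = generate_in_carrier[OF A]
  have conj_A: "conj_by r1 s = inv s" if "s \<in> ?A" for s
    using that r inv by (auto simp: conj_by_def word_simps)
  have conj: "conj_by r1 s \<in> ?S" if "s \<in> ?S" for s
  proof (rule conj_by_generate[OF A r(1) _ that])
    show "conj_by r1 a \<in> ?S" if "a \<in> ?A" for a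
      using that conj_A generate.inv by metis
  qed
  have swap: "s \<otimes> r1 = r1 \<otimes> conj_by r1 s" if "s \<in> carrier G" for s
    using that r inv by (simp add: conj_by_def m_assoc)
  have gens: "\<exists>s\<in>?S. a = r1 \<otimes> s" if "a \<in> {r1, r2, r3}" for a
  proof -
    have "r1 = r1 \<otimes> \<one>" "r2 = r1 \<otimes> inv (r2 \<otimes> r1)" "r3 = r1 \<otimes> (r1 \<otimes> r3)"
      using r inv by (simp_all add: word_simps)
    moreover have "\<one> \<in> ?S" "inv (r2 \<otimes> r1) \<in> ?S" "r1 \<otimes> r3 \<in> ?S"
      by (auto intro: generate.intros)
    ultimately show ?thesis using that by blast
  qed
  show ?thesis
    using g
  proof (induction rule: generate.induct)
    case one
    show ?case using generate.one by blast
  next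
    case (incl a)
    then show ?case using gens by blast
  next
    case (inv a)
    then have "inv a = a" using assms(4-6) by auto
    then show ?case using gens[OF inv] by metis
  next
    case (eng a b)
    then obtain s t where s: "s \<in> ?S" "a = s \<or> a = r1 \<otimes> s" and t: "t \<in> ?S" "b = t \<or> b = r1 \<otimes> t"
      by blast
    have carr: "s \<in> carrier G" "t \<in> carrier G" using s t in_carrier by auto
    have mem: "s \<otimes> t \<in> ?S" "conj_by r1 s \<otimes> t \<in> ?S"
      using s(1) t(1) conj by (auto intro: generate.eng)
    have 1: "s \<otimes> (r1 \<otimes> t) = r1 \<otimes> (conj_by r1 s \<otimes> t)"
      using carr r swap[of s] by (simp flip: m_assoc)
    then have 2: "r1 \<otimes> s \<otimes> (r1 \<otimes> t) = conj_by r1 s \<otimes> t"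
      using carr r by (simp add: m_assoc)
    from s(2) t(2) show ?case
    proof (elim disjE)
      assume "a = s" "b = t"
      then show ?thesis using mem by blast
    next
      assume "a = s" "b = r1 \<otimes> t"
      then show ?thesis using mem 1 by blast
    next
      assume "a = r1 \<otimes> s" "b = t"
      then have "a \<otimes> b = r1 \<otimes> (s \<otimes> t)" using carr r by (simp add: m_assoc)
      then show ?thesis using mem by blast
    next
      assume "a = r1 \<otimes> s" "b = r1 \<otimes> t"
      then show ?thesis using mem 2 by blast
    qed
  qed
qed

theorem theorem5p2:
  fixes A1 A2 A3 :: complex
  assumes "generic_triangle A1 A2 A3"
  shows "tri_presentation (H_tri A1 A2 A3)
           (tri_refl A1 A2 A3 2 \<otimes>\<^bsub>plane_perm_group\<^esub> tri_refl A1 A2 A3 1)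
           (tri_refl A1 A2 A3 1 \<otimes>\<^bsub>plane_perm_group\<^esub> tri_refl A1 A2 A3 3)
           TYPE(('k, 'm) monoid_scheme)"
proof -
  let ?P = "plane_perm_group" and ?H = "H_tri A1 A2 A3"
  define r1 r2 r3 where "r1 = tri_refl A1 A2 A3 1" and "r2 = tri_refl A1 A2 A3 2"
    and "r3 = tri_refl A1 A2 A3 3"
  have r_eq: "r1 = refl_line A2 A3" "r2 = refl_line A3 A1" "r3 = refl_line A1 A2"
    by (simp_all add: r1_def r2_def r3_def tri_refl_def)
  define a2 a3 where "a2 = r2 \<otimes>\<^bsub>?P\<^esub> r1" and "a3 = r1 \<otimes>\<^bsub>?P\<^esub> r3"
  define u v where "u = edge_ratio (A3 - A2) (A1 - A3)" and "v = edge_ratio (A1 - A2) (A3 - A2)"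
  have ne: "A2 \<noteq> A3" "A3 \<noteq> A1" "A1 \<noteq> A2"
    using assms alg_indep3_nonzero unfolding generic_triangle_def by fastforce+
  have r: "r1 \<in> carrier ?P" "r2 \<in> carrier ?P" "r3 \<in> carrier ?P"
    using ne by (simp_all add: r_eq bij_refl_line)
  have inv_r: "inv\<^bsub>?P\<^esub> r1 = r1" "inv\<^bsub>?P\<^esub> r2 = r2" "inv\<^bsub>?P\<^esub> r3 = r3"
    using ne by (simp_all add: r_eq inv_refl_line)
  have a2_eq: "a2 = (\<lambda>z. A3 + u * (z - A3))"
    using refl_line_comp[OF ne(1,2)] by (simp add: a2_def r_eq u_def)
  have "edge_ratio (A2 - A1) (A3 - A2) = v"
    using minus_divide_divide[of "(A1 - A2) * cnj (A3 - A2)" "cnj (A1 - A2) * (A3 - A2)"]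
    by (simp add: v_def edge_ratio_def minus_mult_left del: minus_divide_divide)
  then have a3_eq: "a3 = (\<lambda>z. A2 + v * (z - A2))"
    using refl_line_comp[OF ne(3,1)] by (simp add: a3_def r_eq)
  have norm: "cmod u = 1" "cmod v = 1"
    using ne by (simp_all add: u_def v_def cmod_edge_ratio)
  have SE2: "a2 \<in> SE2" "a3 \<in> SE2"
    by (rule SE2I[of u _ "A3 - u * A3"] SE2I[of v _ "A2 - v * A2"];
        simp add: norm a2_eq a3_eq algebra_simps)+
  have lin: "linear_part a2 = u" "linear_part a3 = v"
    by (simp_all add: linear_part_def a2_eq a3_eq algebra_simps)
  have G_sub: "subgroup (G_tri A1 A2 A3) ?P"
    unfolding G_tri_def using r by (intro plane.generate_is_subgroup) (simp add: r1_def r2_def r3_def)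
  have G_eq: "G_tri A1 A2 A3 = generate ?P {r1, r2, r3}"
    by (simp add: G_tri_def r1_def r2_def r3_def)
  have H_sub: "subgroup (G_tri A1 A2 A3 \<inter> SE2) ?P"
    by (rule plane.subgroups_Inter_pair[OF G_sub subgroup_SE2])
  interpret H: se2_group ?H
    unfolding se2_group_def se2_group_axioms_def
    using plane.subgroup_imp_group[OF H_sub] by (simp add: H_tri_def)
  have "r1 \<in> G_tri A1 A2 A3" "r2 \<in> G_tri A1 A2 A3" "r3 \<in> G_tri A1 A2 A3"
    unfolding G_eq by (auto intro: generate.incl)
  then have mem: "a2 \<in> carrier ?H" "a3 \<in> carrier ?H"
    using SE2 subgroup.m_closed[OF G_sub] by (simp_all add: H_tri_def a2_def a3_def)
  have gen_sub: "{a2, a3} \<subseteq> G_tri A1 A2 A3 \<inter> SE2" using mem by (simp add: H_tri_def)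
  have gen_eq: "generate ?H {a2, a3} = generate ?P {a2, a3}"
    unfolding H_tri_def by (rule plane.generate_consistent[OF gen_sub H_sub])
  have "carrier ?H \<subseteq> generate ?H {a2, a3}"
  proof
    fix g assume "g \<in> carrier ?H"
    then have g: "g \<in> generate ?P {r1, r2, r3}" "g \<in> SE2" by (simp_all add: H_tri_def G_eq)
    obtain s where s: "s \<in> generate ?P {a2, a3}" "g = s \<or> g = r1 \<otimes>\<^bsub>?P\<^esub> s"
      using plane.involutions_even_or_odd[OF r inv_r g(1)] unfolding a2_def a3_def by blast
    have "s \<in> SE2"
      using s(1) plane.generate_subgroup_incl[OF _ subgroup_SE2, of "{a2, a3}"] SE2 by auto
    have "g \<noteq> r1 \<otimes>\<^bsub>?P\<^esub> s"
    proof
      assume "g = r1 \<otimes>\<^bsub>?P\<^esub> s"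
      then have "r1 = g \<otimes>\<^bsub>?P\<^esub> inv\<^bsub>?P\<^esub> s"
        using r \<open>s \<in> SE2\<close> subgroup.mem_carrier[OF subgroup_SE2]
        by (metis plane.inv_solve_right plane.m_closed)
      then have "r1 \<in> SE2"
        using g(2) \<open>s \<in> SE2\<close> subgroup.m_closed[OF subgroup_SE2] subgroup.m_inv_closed[OF subgroup_SE2]
        by metis
      then show False using refl_line_not_SE2[OF ne(1)] r_eq by simp
    qed
    then show "g \<in> generate ?H {a2, a3}" using s gen_eq by simp
  qed
  moreover have "generate ?H {a2, a3} \<subseteq> carrier ?H"
    using mem by (intro H.generate_incl) simp
  ultimately have gen: "carrier ?H = generate ?H {a2, a3}" by blast
  have indep: "laurent_independent u v"
    using generic_laurent_independent[OF assms] by (simp add: u_def v_def)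
  have ne_one: "u powi n * v powi m \<noteq> 1" if "(n, m) \<noteq> (0, 0)" for n m
  proof
    assume "u powi n * v powi m = 1"
    then have "laurent_eval u v (frag_of (n, m) - frag_of (0, 0)) = 0"
      by (simp add: laurent_eval_diff laurent_eval_frag_of)
    then have "frag_of (n, m) = frag_of (0::int, 0::int)"
      using indep unfolding laurent_independent_def by (metis eq_iff_diff_eq_0)
    then show False using that by (simp add: frag_of_eq)
  qed
  have "a2 \<otimes>\<^bsub>?H\<^esub> a3 \<noteq> a3 \<otimes>\<^bsub>?H\<^esub> a2"
  proof
    assume "a2 \<otimes>\<^bsub>?H\<^esub> a3 = a3 \<otimes>\<^bsub>?H\<^esub> a2"
    then have "a3 (a2 A3) = a2 (a3 A3)" by (metis H.mult_eq comp_apply)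
    then have "(A3 - A2) * (v - 1) * (1 - u) = 0"
      by (simp add: a2_eq a3_eq algebra_simps)
    then show False using ne(1) ne_one[of 1 0] ne_one[of 0 1] by auto
  qed
  then have "gcomm ?H a2 a3 \<noteq> \<one>\<^bsub>?H\<^esub>"
    using mem by (simp add: H.gcomm_eq_one_iff)
  then have "tri_presentation ?H a2 a3 TYPE(('k, 'm) monoid_scheme)"
    using H.tri_presentation[OF mem _ gen] indep lin by simp
  then show ?thesis by (simp only: a2_def a3_def r1_def r2_def r3_def)
qed

end
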